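(* Let $\mathfrak{H}$ be a complex Hilbert space and let $A$ and $H$ be self-adjoint operators in $\mathfrak{H}$ such that (i) $\inf\operatorname{spec}(A)>0$; (ii) $H$ is bounded and has a bounded inverse; (iii) the open interval $(h_-,h_+)$ is the maximal spectral gap of $H$ containing $0$. Let $\mathfrak{b}$ be the symmetric sesquilinear form $$\mathfrak{b}[x,y]=\langle A^{1/2}x,HA^{1/2}y\rangle,\qquad x,y\in\operatorname{Dom}[\mathfrak{b}]=\operatorname{Dom}(A^{1/2}),$$ and let $B:=A^{1/2}HA^{1/2}$ be the (self-adjoint) operator with domain $\operatorname{Dom}(B)=\{x\in\operatorname{Dom}(A^{1/2})\mid HA^{1/2}x\in\operatorname{Dom}(A^{1/2})\}$. Then $B$ is the unique self-adjoint operator with $\operatorname{Dom}(B)\subset\operatorname{Dom}[\mathfrak{b}]$ that is associated with the form $\mathfrak{b}$ in the sense that $$\mathfrak{b}[x,y]=\langle x,By\rangle\quad\text{for all } x\in\operatorname{Dom}[\mathfrak{b}],\ y\in\operatorname{Dom}(B)\subset\operatorname{Dom}[\mathfrak{b}],$$ and $\operatorname{Dom}(B)$ is a core for $A^{1/2}$. Moreover, the open interval $(\alpha h_-,\alpha h_+)$, with $\alpha=\min\operatorname{spec}(A)$, belongs to the resolvent set of $B$.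
   Context: Inner products and sesquilinear forms are linear in the second argument and conjugate-linear in the first. Self-adjoint operators may be unbounded and are densely defined. The maximal spectral gap of $H$ containing $0$ is the largest open interval containing $0$ that is contained in the resolvent set of $H$ (an endpoint may be infinite). *)

theory Defs
  imports "HOL-Analysis.Analysis"
begin

text \<open>Complex Hilbert spaces: Banach spaces whose norm comes from a complex inner product,
  linear in the second and conjugate-linear in the first argument.\<close>

class complex_hilbert = banach +
  fixes scaleC :: "complex \<Rightarrow> 'a \<Rightarrow> 'a" (infixr "*\<^sub>C" 75)
    and cinner :: "'a \<Rightarrow> 'a \<Rightarrow> complex"
  assumes scaleC_of_real: "complex_of_real r *\<^sub>C x = r *\<^sub>R x"
    and scaleC_add_right: "a *\<^sub>C (x + y) = a *\<^sub>C x + a *\<^sub>C y"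
    and scaleC_add_left: "(a + b) *\<^sub>C x = a *\<^sub>C x + b *\<^sub>C x"
    and scaleC_scaleC: "a *\<^sub>C b *\<^sub>C x = (a * b) *\<^sub>C x"
    and cinner_commute: "cinner x y = cnj (cinner y x)"
    and cinner_add_right: "cinner x (y + z) = cinner x y + cinner x z"
    and cinner_scaleC_right: "cinner x (a *\<^sub>C y) = a * cinner x y"
    and cinner_self: "cinner x x = complex_of_real ((norm x)\<^sup>2)"

definition csubspace :: "'a::complex_hilbert set \<Rightarrow> bool" where
  "csubspace D \<longleftrightarrow> 0 \<in> D \<and> (\<forall>x\<in>D. \<forall>y\<in>D. x + y \<in> D) \<and> (\<forall>c. \<forall>x\<in>D. c *\<^sub>C x \<in> D)"

text \<open>A possibly unbounded operator is a partial map, so equality of operators includes equality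
  of domains, and \<open>S \<circ>\<^sub>m T\<close> is the product \<open>S T\<close> on its maximal domain
  \<open>{x \<in> dom T. T x \<in> dom S}\<close>.\<close>

definition linear_operator :: "('a::complex_hilbert \<rightharpoonup> 'a) \<Rightarrow> bool" where
  "linear_operator T \<longleftrightarrow> csubspace (dom T)
    \<and> (\<forall>x\<in>dom T. \<forall>y\<in>dom T. the (T (x + y)) = the (T x) + the (T y))
    \<and> (\<forall>c. \<forall>x\<in>dom T. the (T (c *\<^sub>C x)) = c *\<^sub>C the (T x))"

definition densely_defined :: "('a::complex_hilbert \<rightharpoonup> 'a) \<Rightarrow> bool" where
  "densely_defined T \<longleftrightarrow> closure (dom T) = UNIV"

text \<open>Only meaningful for densely defined \<open>T\<close>, where the vector \<open>z\<close> is unique.\<close>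

definition adjoint_op :: "('a::complex_hilbert \<rightharpoonup> 'a) \<Rightarrow> ('a \<rightharpoonup> 'a)" where
  "adjoint_op T = (\<lambda>x.
     if \<exists>z. \<forall>y\<in>dom T. cinner x (the (T y)) = cinner z y
     then Some (THE z. \<forall>y\<in>dom T. cinner x (the (T y)) = cinner z y)
     else None)"

definition self_adjoint :: "('a::complex_hilbert \<rightharpoonup> 'a) \<Rightarrow> bool" where
  "self_adjoint T \<longleftrightarrow> linear_operator T \<and> densely_defined T \<and> adjoint_op T = T"

definition nonneg_op :: "('a::complex_hilbert \<rightharpoonup> 'a) \<Rightarrow> bool" where
  "nonneg_op T \<longleftrightarrow> (\<forall>x\<in>dom T. 0 \<le> Re (cinner x (the (T x))))"

definition bounded_op :: "('a::complex_hilbert \<rightharpoonup> 'a) \<Rightarrow> bool" where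
  "bounded_op T \<longleftrightarrow> (\<exists>K. \<forall>x\<in>dom T. norm (the (T x)) \<le> K * norm x)"

text \<open>The inverse exists, is defined on the whole space, and is bounded.\<close>

definition has_bounded_inverse :: "('a::complex_hilbert \<rightharpoonup> 'a) \<Rightarrow> bool" where
  "has_bounded_inverse T \<longleftrightarrow> bij_betw (\<lambda>x. the (T x)) (dom T) UNIV
    \<and> (\<exists>K. \<forall>x\<in>dom T. norm x \<le> K * norm (the (T x)))"

definition shift_op :: "('a::complex_hilbert \<rightharpoonup> 'a) \<Rightarrow> complex \<Rightarrow> ('a \<rightharpoonup> 'a)" where
  "shift_op T z = (\<lambda>x. map_option (\<lambda>y. y - z *\<^sub>C x) (T x))"

definition resolvent_set :: "('a::complex_hilbert \<rightharpoonup> 'a) \<Rightarrow> complex set" where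
  "resolvent_set T = {z. has_bounded_inverse (shift_op T z)}"

definition spectrum_op :: "('a::complex_hilbert \<rightharpoonup> 'a) \<Rightarrow> complex set" where
  "spectrum_op T = - resolvent_set T"

text \<open>For self-adjoint \<open>T\<close> the spectrum is real, so \<open>Re\<close> only changes its type. The infimum is
  extended real: it is \<open>\<infinity>\<close> exactly when the spectrum is empty, that is, on the zero space.\<close>

definition inf_spec :: "('a::complex_hilbert \<rightharpoonup> 'a) \<Rightarrow> ereal" where
  "inf_spec T = (INF z\<in>spectrum_op T. ereal (Re z))"

definition maximal_spectral_gap :: "('a::complex_hilbert \<rightharpoonup> 'a) \<Rightarrow> ereal \<Rightarrow> ereal \<Rightarrow> bool" where
  "maximal_spectral_gap T a b \<longleftrightarrow>
     a < 0 \<and> 0 < b \<and> complex_of_real ` einterval a b \<subseteq> resolvent_set T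
     \<and> (\<forall>a' b'. a' < 0 \<and> 0 < b' \<and> complex_of_real ` einterval a' b' \<subseteq> resolvent_set T
          \<longrightarrow> a \<le> a' \<and> b' \<le> b)"

definition sqrt_op :: "('a::complex_hilbert \<rightharpoonup> 'a) \<Rightarrow> ('a \<rightharpoonup> 'a)" where
  "sqrt_op A = (THE S. self_adjoint S \<and> nonneg_op S \<and> S \<circ>\<^sub>m S = A)"

definition is_core :: "'a::complex_hilbert set \<Rightarrow> ('a \<rightharpoonup> 'a) \<Rightarrow> bool" where
  "is_core D T \<longleftrightarrow> csubspace D \<and> D \<subseteq> dom T
    \<and> closure (Map.graph (T |` D)) = Map.graph T"

definition form_dom :: "('a::complex_hilbert \<rightharpoonup> 'a) \<Rightarrow> 'a set" where
  "form_dom A = dom (sqrt_op A)"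

definition form ::
  "('a::complex_hilbert \<rightharpoonup> 'a) \<Rightarrow> ('a \<rightharpoonup> 'a) \<Rightarrow> 'a \<Rightarrow> 'a \<Rightarrow> complex" where
  "form A H x y = cinner (the (sqrt_op A x)) (the (H (the (sqrt_op A y))))"

definition associated_with_form ::
  "('a::complex_hilbert \<rightharpoonup> 'a) \<Rightarrow> 'a set \<Rightarrow> ('a \<Rightarrow> 'a \<Rightarrow> complex) \<Rightarrow> bool" where
  "associated_with_form T D b \<longleftrightarrow>
     dom T \<subseteq> D \<and> (\<forall>x\<in>D. \<forall>y\<in>dom T. b x y = cinner x (the (T y)))"

definition form_op ::
  "('a::complex_hilbert \<rightharpoonup> 'a) \<Rightarrow> ('a \<rightharpoonup> 'a) \<Rightarrow> ('a \<rightharpoonup> 'a)" where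
  "form_op A H = sqrt_op A \<circ>\<^sub>m H \<circ>\<^sub>m sqrt_op A"

lemma dom_form_op:
  assumes "dom H = UNIV"
  shows "dom (form_op A H) =
    {x \<in> dom (sqrt_op A). the (H (the (sqrt_op A x))) \<in> dom (sqrt_op A)}"
proof (intro set_eqI iffI)
  fix x
  have H: "H v \<noteq> None" for v
    using assms by blast
  show "x \<in> dom (form_op A H)"
    if "x \<in> {x \<in> dom (sqrt_op A). the (H (the (sqrt_op A x))) \<in> dom (sqrt_op A)}"
    using that H[of "the (sqrt_op A x)"] by (auto simp: form_op_def)
  show "x \<in> {x \<in> dom (sqrt_op A). the (H (the (sqrt_op A x))) \<in> dom (sqrt_op A)}"
    if "x \<in> dom (form_op A H)"
    using that by (auto simp: form_op_def map_comp_def dom_def split: option.splits)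
qed

end

theory Submission
  imports Defs
begin

text \<open>If \<open>R\<close> is the inverse of \<open>A\<^bsup>1/2\<^esup>\<close>, then \<open>B\<close>
  is the inverse of the bounded symmetric injective operator \<open>R H\<^bsup>-1\<^esup> R\<close>, and the inverse of such an
  operator is always self-adjoint. This avoids the spectral theorem: \<open>R\<close> is the norm limit of an
  iteration started from \<open>A\<^bsup>-1\<^esup>\<close>, and the only spectral input is that for real \<open>s\<close> in the resolvent
  set of a self-adjoint \<open>T\<close>, one of the points \<open>s \<plusminus> 1 / M\<close> with \<open>M\<close> the norm of \<open>(T - s)\<^bsup>-1\<^esup>\<close> is in
  the spectrum. It gives \<open>\<parallel>(T - s) x\<parallel> \<ge> d \<parallel>x\<parallel>\<close> whenever the spectrum has distance at least \<open>d\<close>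
  from \<open>s\<close>; letting \<open>s \<rightarrow> -\<infinity>\<close> for \<open>T = A\<close> yields \<open>A \<ge> \<alpha>\<close>, and \<open>T = H\<close> yields the gap of \<open>B\<close>.\<close>

section \<open>Geometry of complex Hilbert spaces\<close>

lemma cinner_add_left: "cinner (x + y) z = cinner x z + cinner y z"
  by (metis cinner_add_right cinner_commute complex_cnj_add)

lemma cinner_scaleC_left: "cinner (a *\<^sub>C x) y = cnj a * cinner x y"
  by (metis cinner_commute cinner_scaleC_right complex_cnj_mult)

lemma scaleC_zero_left [simp]: "0 *\<^sub>C x = 0"
  using scaleC_of_real[of 0 x] by simp

lemma scaleC_zero_right [simp]: "a *\<^sub>C 0 = 0"
  using scaleC_add_right[of a 0 0] by simp

lemma scaleC_minus_right: "a *\<^sub>C (- x) = - (a *\<^sub>C x)"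
  by (metis add.right_inverse add_eq_0_iff scaleC_add_right scaleC_zero_right)

lemma scaleC_diff_right: "a *\<^sub>C (x - y) = a *\<^sub>C x - a *\<^sub>C y"
  using scaleC_add_right[of a x "- y"] by (simp add: scaleC_minus_right)

lemma cinner_scaleR_right: "cinner x (r *\<^sub>R y) = r *\<^sub>R cinner x y"
  by (metis cinner_scaleC_right scaleC_of_real scaleR_conv_of_real)

lemma cinner_scaleR_left: "cinner (r *\<^sub>R x) y = r *\<^sub>R cinner x y"
  by (metis cinner_scaleC_left complex_cnj_complex_of_real scaleC_of_real scaleR_conv_of_real)

lemma norm_add_sq:
  fixes x y :: "'a::complex_hilbert"
  shows "(norm (x + y))\<^sup>2 = (norm x)\<^sup>2 + 2 * Re (cinner x y) + (norm y)\<^sup>2"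
proof -
  have "cinner (x + y) (x + y) = cinner x x + (cinner x y + cnj (cinner x y)) + cinner y y"
    by (simp add: cinner_add_left cinner_add_right flip: cinner_commute)
  then have "complex_of_real ((norm (x + y))\<^sup>2) = complex_of_real ((norm x)\<^sup>2 + 2 * Re (cinner x y) + (norm y)\<^sup>2)"
    by (simp add: cinner_self complex_add_cnj)
  then show ?thesis
    using of_real_eq_iff by blast
qed

lemma norm_scaleC: "norm (a *\<^sub>C x) = norm a * norm x"
proof -
  have "complex_of_real ((norm (a *\<^sub>C x))\<^sup>2) = (a * cnj a) * cinner x x"
    unfolding cinner_self[symmetric] by (simp add: cinner_scaleC_left cinner_scaleC_right)
  also have "\<dots> = complex_of_real ((norm a * norm x)\<^sup>2)"
    unfolding complex_norm_square[symmetric] cinner_self by (simp add: power_mult_distrib)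
  finally have "complex_of_real ((norm (a *\<^sub>C x))\<^sup>2) = complex_of_real ((norm a * norm x)\<^sup>2)" .
  then have "(norm (a *\<^sub>C x))\<^sup>2 = (norm a * norm x)\<^sup>2"
    using of_real_eq_iff by blast
  then show ?thesis
    by simp
qed

text \<open>Pythagoras for the component of \<open>x\<close> along \<open>y\<close>. It is used
  twice: the left side being nonnegative gives Cauchy-Schwarz, and the left side being minimal at a
  nearest point gives orthogonality.\<close>

lemma norm_diff_projection_sq:
  fixes x y :: "'a::complex_hilbert"
  assumes "y \<noteq> 0"
  defines "c \<equiv> cinner y x / complex_of_real ((norm y)\<^sup>2)"
  shows "(norm (x - c *\<^sub>C y))\<^sup>2 = (norm x)\<^sup>2 - (norm (cinner x y))\<^sup>2 / (norm y)\<^sup>2"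
proof -
  have sq: "cinner y x * cinner x y = complex_of_real ((norm (cinner x y))\<^sup>2)"
    by (metis cinner_commute complex_norm_square mult.commute)
  have c: "norm c = norm (cinner x y) / (norm y)\<^sup>2"
    by (metis c_def cinner_commute complex_mod_cnj norm_divide norm_of_real abs_power2)
  have "cinner x (c *\<^sub>C y) = complex_of_real ((norm (cinner x y))\<^sup>2 / (norm y)\<^sup>2)"
    using sq by (simp add: cinner_scaleC_right c_def)
  moreover have "(norm (c *\<^sub>C y))\<^sup>2 = (norm (cinner x y))\<^sup>2 / (norm y)\<^sup>2"
    using assms(1) by (simp add: norm_scaleC c power2_eq_square)
  moreover have "cinner x (- (c *\<^sub>C y)) = - cinner x (c *\<^sub>C y)"
    using cinner_scaleR_right[of x "-1"] by simp
  ultimately show ?thesis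
    using norm_add_sq[of x "- (c *\<^sub>C y)"] by simp
qed

lemma norm_cinner_le: "norm (cinner x y) \<le> norm x * norm y"
proof (cases "y = 0")
  case True
  then show ?thesis
    using cinner_scaleC_right[of x 0 y] by simp
next
  case False
  then have "(norm (cinner x y))\<^sup>2 / (norm y)\<^sup>2 \<le> (norm x)\<^sup>2"
    using norm_diff_projection_sq[OF False, of x] zero_le_power2 by (metis diff_ge_0_iff_ge)
  then have "(norm (cinner x y))\<^sup>2 \<le> (norm x * norm y)\<^sup>2"
    using False by (simp add: divide_le_eq power_mult_distrib)
  then show ?thesis
    by (simp add: power2_le_iff_abs_le)
qed

lemma bounded_bilinear_cinner: "bounded_bilinear cinner"
  by standard (auto simp: cinner_add_left cinner_add_right cinner_scaleR_left cinner_scaleR_right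
      intro!: exI[of _ 1] norm_cinner_le)

interpretation cinner: bounded_bilinear cinner
  by (rule bounded_bilinear_cinner)

lemma bounded_linear_scaleC: "bounded_linear (\<lambda>x. a *\<^sub>C x)"
proof (rule bounded_linear_intro[where K = "norm a"])
  fix r x
  show "a *\<^sub>C (r *\<^sub>R x) = r *\<^sub>R (a *\<^sub>C x)"
    by (metis mult.commute scaleC_of_real scaleC_scaleC)
qed (simp_all add: scaleC_add_right norm_scaleC mult.commute)

lemma cinner_eq_imp_eq:
  assumes "\<And>y. cinner x y = cinner x' y"
  shows "x = x'"
  using assms[of "x - x'"] cinner_self[of "x - x'"] by (simp add: cinner.diff_left)

lemma cinner_eq_on_dense_imp_eq:
  assumes "closure D = UNIV" and "\<And>y. y \<in> D \<Longrightarrow> cinner x y = cinner x' y"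
  shows "x = x'"
proof (rule cinner_eq_imp_eq)
  fix y
  obtain f where f: "\<And>n. f n \<in> D" "f \<longlonglongrightarrow> y"
    using assms(1) closure_sequential by (metis UNIV_I)
  then have "(\<lambda>n. cinner x (f n)) \<longlonglongrightarrow> cinner x y" "(\<lambda>n. cinner x' (f n)) \<longlonglongrightarrow> cinner x' y"
    by (auto intro!: cinner.tendsto)
  then have "(\<lambda>n. cinner x (f n)) \<longlonglongrightarrow> cinner x y" "(\<lambda>n. cinner x (f n)) \<longlonglongrightarrow> cinner x' y"
    using assms(2) f(1) by auto
  then show "cinner x y = cinner x' y"
    by (rule LIMSEQ_unique)
qed

section \<open>Nearest points and density of subspaces\<close>

text \<open>The parallelogram law for \<open>x - u\<close> and \<open>x - v\<close>, written with
  the midpoint: in a convex set the midpoint is no closer to \<open>x\<close> than the infimum, so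
  two almost nearest points are close to each other.\<close>

lemma parallelogram_midpoint:
  fixes x u v :: "'a::complex_hilbert"
  shows "(norm (u - v))\<^sup>2
    = 2 * (norm (x - u))\<^sup>2 + 2 * (norm (x - v))\<^sup>2 - 4 * (norm (x - (1/2) *\<^sub>R (u + v)))\<^sup>2"
proof -
  define p q where "p = x - u" and "q = x - v"
  have "u - v = q + (- 1) *\<^sub>R p"
    by (simp add: p_def q_def)
  moreover have "2 *\<^sub>R (x - (1/2) *\<^sub>R (u + v)) = q + p"
    by (simp add: p_def q_def algebra_simps scaleR_2)
  then have "4 * (norm (x - (1/2) *\<^sub>R (u + v)))\<^sup>2 = (norm (q + p))\<^sup>2"
    by (metis norm_scaleR power_mult_distrib abs_numeral four_x_squared)
  ultimately show ?thesis
    using norm_add_sq[of q "(- 1) *\<^sub>R p"] norm_add_sq[of q p]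
    by (simp add: cinner_scaleR_right cinner.minus_right flip: p_def q_def)
qed

text \<open>A minimizing sequence in \<open>D\<close> is Cauchy by the midpoint identity. Its limit
  realizes the infimum over \<open>D\<close>, which is also a lower bound on the closure by
  continuity.\<close>

lemma nearest_point_closure:
  fixes D :: "'a::complex_hilbert set"
  assumes "convex D" "D \<noteq> {}"
  shows "\<exists>p\<in>closure D. \<forall>y\<in>closure D. norm (x - p) \<le> norm (x - y)"
proof -
  define d where "d = infdist x D"
  have d: "d \<le> norm (x - y)" if "y \<in> D" for y
    using infdist_le[OF that, of x] by (simp add: d_def dist_norm)
  \<comment> \<open>The error is placed on the squared distance because the midpoint identity is
    quadratic; the terms in \<open>d\<close> then cancel and leave
    \<open>2 / Suc m + 2 / Suc n\<close>.\<close>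
  have "\<exists>y\<in>D. (norm (x - y))\<^sup>2 < d\<^sup>2 + 1 / Suc n" for n
  proof -
    have "d < sqrt (d\<^sup>2 + 1 / Suc n)"
      by (simp add: real_less_rsqrt)
    then obtain y where y: "y \<in> D" "norm (x - y) < sqrt (d\<^sup>2 + 1 / Suc n)"
      using assms(2) cInf_lessD[of "dist x ` D" "sqrt (d\<^sup>2 + 1 / Suc n)"]
      by (auto simp: d_def infdist_def dist_norm)
    from y(2) have "(norm (x - y))\<^sup>2 < (sqrt (d\<^sup>2 + 1 / Suc n))\<^sup>2"
      by (intro power_strict_mono) auto
    with y(1) show ?thesis
      by (auto simp: add_nonneg_nonneg)
  qed
  then obtain f where f: "f n \<in> D" "(norm (x - f n))\<^sup>2 < d\<^sup>2 + 1 / Suc n" for n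
    by metis
  have fd: "(norm (f m - f n))\<^sup>2 \<le> 2 / Suc m + 2 / Suc n" for m n
  proof -
    have "(1/2) *\<^sub>R (f m + f n) \<in> D"
      using convexD[OF assms(1) f(1)[of m] f(1)[of n], of "1/2" "1/2"]
      by (simp add: scaleR_add_right)
    then have "d\<^sup>2 \<le> (norm (x - (1/2) *\<^sub>R (f m + f n)))\<^sup>2"
      by (intro power_mono d) (simp_all add: d_def infdist_nonneg)
    then show ?thesis
      using f(2)[of m] f(2)[of n] parallelogram_midpoint[of "f m" "f n" x] by simp
  qed
  have "Cauchy f"
  proof (rule CauchyI)
    fix e :: real
    assume "e > 0"
    then obtain N where N: "1 / Suc N < e\<^sup>2 / 4"
      using nat_approx_posE[of "e\<^sup>2 / 4"] by auto
    have "norm (f m - f n) < e" if "m \<ge> N" "n \<ge> N" for m n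
    proof -
      have "1 / Suc m \<le> 1 / Suc N" "1 / Suc n \<le> 1 / Suc N"
        using that by (simp_all add: divide_simps)
      then have "(norm (f m - f n))\<^sup>2 < e\<^sup>2"
        using fd[of m n] N by simp
      then show ?thesis
        using \<open>e > 0\<close> by (simp add: power_less_imp_less_base)
    qed
    then show "\<exists>M. \<forall>m\<ge>M. \<forall>n\<ge>M. norm (f m - f n) < e"
      by blast
  qed
  then obtain p where p: "f \<longlonglongrightarrow> p"
    using Cauchy_convergent convergent_def by blast
  have "(norm (x - p))\<^sup>2 \<le> d\<^sup>2"
  proof (rule LIMSEQ_le)
    show "(\<lambda>n. (norm (x - f n))\<^sup>2) \<longlonglongrightarrow> (norm (x - p))\<^sup>2"
      by (intro tendsto_intros p)
    show "(\<lambda>n. d\<^sup>2 + 1 / real (Suc n)) \<longlonglongrightarrow> d\<^sup>2"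
      using tendsto_add[OF tendsto_const[of "d\<^sup>2"] LIMSEQ_inverse_real_of_nat]
      by (simp add: inverse_eq_divide)
    show "\<exists>N. \<forall>n\<ge>N. (norm (x - f n))\<^sup>2 \<le> d\<^sup>2 + 1 / real (Suc n)"
      using f(2) less_imp_le by blast
  qed
  then have "norm (x - p) \<le> d"
    by (rule power2_le_imp_le) (simp add: d_def infdist_nonneg)
  moreover have "closure D \<subseteq> {y. d \<le> norm (x - y)}"
    using d by (intro closure_minimal closed_Collect_le continuous_intros) auto
  moreover have "p \<in> closure D"
    using f(1) p closure_sequential by blast
  ultimately show ?thesis
    by (blast intro: order_trans)
qed

lemma csubspaceD:
  assumes "csubspace D"
  shows "0 \<in> D" "x \<in> D \<Longrightarrow> y \<in> D \<Longrightarrow> x + y \<in> D" "x \<in> D \<Longrightarrow> c *\<^sub>C x \<in> D"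
  using assms unfolding csubspace_def by auto

lemma csubspace_imp_convex: "csubspace D \<Longrightarrow> convex D"
  unfolding convex_def csubspace_def by (metis scaleC_of_real)

text \<open>If \<open>p\<close> is nearest to \<open>x\<close> in the closure, then
  \<open>x - p\<close> is orthogonal to \<open>D\<close>: otherwise adding to \<open>p\<close> the
  projection of \<open>x - p\<close> onto some \<open>y\<close> in \<open>D\<close> would come
  closer. Hence \<open>x = p\<close>.\<close>

lemma csubspace_dense_if_no_orthogonal:
  fixes D :: "'a::complex_hilbert set"
  assumes "csubspace D" and orth: "\<And>z. (\<And>y. y \<in> D \<Longrightarrow> cinner z y = 0) \<Longrightarrow> z = 0"
  shows "closure D = UNIV"
proof -
  have "x \<in> closure D" for x
  proof -
    obtain p where p: "p \<in> closure D" "\<And>y. y \<in> closure D \<Longrightarrow> norm (x - p) \<le> norm (x - y)"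
      using nearest_point_closure[OF csubspace_imp_convex[OF assms(1)]] csubspaceD(1)[OF assms(1)]
      by blast
    have "cinner (x - p) y = 0" if y: "y \<in> D" for y
    proof (cases "y = 0")
      case False
      define c where "c = cinner y (x - p) / complex_of_real ((norm y)\<^sup>2)"
      obtain f where f: "\<And>n. f n \<in> D" "f \<longlonglongrightarrow> p"
        using p(1) closure_sequential by metis
      have "p + c *\<^sub>C y \<in> closure D"
        unfolding closure_sequential
        using f csubspaceD[OF assms(1)] y
        by (intro exI[of _ "\<lambda>n. f n + c *\<^sub>C y"]) (auto intro: tendsto_add tendsto_const)
      then have "norm (x - p) \<le> norm (x - p - c *\<^sub>C y)"
        using p(2) by (metis diff_diff_eq)
      then have "(norm (x - p))\<^sup>2 \<le> (norm (x - p - c *\<^sub>C y))\<^sup>2"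
        by (simp add: power_mono)
      then have "(norm (cinner (x - p) y))\<^sup>2 / (norm y)\<^sup>2 \<le> 0"
        using norm_diff_projection_sq[OF False, of "x - p"] unfolding c_def by linarith
      then show ?thesis
        using False by (simp add: divide_le_0_iff)
    qed (simp add: cinner.zero_right)
    then have "x - p = 0"
      by (rule orth)
    then show ?thesis
      using p(1) by simp
  qed
  then show ?thesis
    by blast
qed


section \<open>Self-adjoint operators\<close>

lemma linear_operatorD:
  assumes "linear_operator T" "T x = Some u" "T y = Some v"
  shows "T (x + y) = Some (u + v)" "T (c *\<^sub>C x) = Some (c *\<^sub>C u)"
    "T 0 = Some 0" "T (x - y) = Some (u - v)"
proof -
  have csub: "csubspace (dom T)"
    using assms(1) by (simp add: linear_operator_def)
  have add: "T (x + y) = Some (u + v)" if "T x = Some u" "T y = Some v" for x y u v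
  proof -
    have "x + y \<in> dom T"
      using that csubspaceD(2)[OF csub] by blast
    moreover have "the (T (x + y)) = the (T x) + the (T y)"
      using assms(1) that unfolding linear_operator_def by blast
    ultimately show ?thesis
      using that by auto
  qed
  have scale: "T (c *\<^sub>C x) = Some (c *\<^sub>C u)" if "T x = Some u" for c x u
  proof -
    have "c *\<^sub>C x \<in> dom T"
      using that csubspaceD(3)[OF csub] by blast
    moreover have "the (T (c *\<^sub>C x)) = c *\<^sub>C the (T x)"
      using assms(1) that unfolding linear_operator_def by blast
    ultimately show ?thesis
      using that by auto
  qed
  show "T (x + y) = Some (u + v)" "T (c *\<^sub>C x) = Some (c *\<^sub>C u)"
    using add scale assms by auto
  show "T 0 = Some 0"
    using scale[OF assms(2), of 0] by simp
  have "(- 1) *\<^sub>C z = - z" for z :: 'a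
    using scaleC_of_real[of "- 1" z] by simp
  then show "T (x - y) = Some (u - v)"
    using add[OF assms(2) scale[OF assms(3), of "- 1"]] by simp
qed

text \<open>Density makes the vector in the definite description unique, so
  \<open>adjoint_op\<close> can be replaced by its defining relation from here on.\<close>

lemma adjoint_op_eq_Some_iff:
  assumes "densely_defined T"
  shows "adjoint_op T x = Some z \<longleftrightarrow> (\<forall>y v. T y = Some v \<longrightarrow> cinner x v = cinner z y)"
proof -
  define P where "P z \<longleftrightarrow> (\<forall>y\<in>dom T. cinner x (the (T y)) = cinner z y)" for z
  have adj: "adjoint_op T x = (if \<exists>z. P z then Some (THE z. P z) else None)"
    by (simp add: adjoint_op_def P_def)
  have uniq: "z = z'" if "P z" "P z'" for z z'
    using that assms unfolding P_def
    by (intro cinner_eq_on_dense_imp_eq[of "dom T"]) (auto simp: densely_defined_def)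
  have "adjoint_op T x = Some z \<longleftrightarrow> P z"
  proof
    assume "adjoint_op T x = Some z"
    then have "\<exists>z. P z" and z: "z = (THE z. P z)"
      by (auto simp: adj split: if_splits)
    then have "\<exists>!z. P z"
      using uniq by blast
    then show "P z"
      unfolding z by (rule theI')
  next
    assume z: "P z"
    have "(THE z. P z) = z"
      using z uniq[OF _ z] by (rule the_equality[of P])
    with z show "adjoint_op T x = Some z"
      by (auto simp: adj)
  qed
  also have "\<dots> \<longleftrightarrow> (\<forall>y v. T y = Some v \<longrightarrow> cinner x v = cinner z y)"
    by (auto simp: P_def dom_def)
  finally show ?thesis .
qed

lemma self_adjointD:
  assumes "self_adjoint T"
  shows "linear_operator T" "densely_defined T"
    "T x = Some z \<longleftrightarrow> (\<forall>y v. T y = Some v \<longrightarrow> cinner x v = cinner z y)"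
  using assms adjoint_op_eq_Some_iff[of T x z] by (auto simp: self_adjoint_def)

lemma self_adjoint_symmetric:
  assumes "self_adjoint T" "T x = Some u" "T y = Some v"
  shows "cinner x v = cinner u y"
  using self_adjointD(3)[OF assms(1)] assms(2,3) by blast

text \<open>For each fixed \<open>y\<close> in the domain the symmetry relation passes to the limit,
  and this relation for all such \<open>y\<close> is membership in the graph of the adjoint, which
  is \<open>T\<close>.\<close>

lemma self_adjoint_closed:
  assumes "self_adjoint T" "\<And>n. T (f n) = Some (g n)" "f \<longlonglongrightarrow> x" "g \<longlonglongrightarrow> u"
  shows "T x = Some u"
proof -
  have "cinner x v = cinner u y" if "T y = Some v" for y v
  proof (rule LIMSEQ_unique)
    show "(\<lambda>n. cinner (f n) v) \<longlonglongrightarrow> cinner x v"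
      by (intro cinner.tendsto assms tendsto_const)
    have "cinner (f n) v = cinner (g n) y" for n
      using self_adjoint_symmetric[OF assms(1) assms(2) that] .
    then show "(\<lambda>n. cinner (f n) v) \<longlonglongrightarrow> cinner u y"
      using cinner.tendsto[OF assms(4) tendsto_const[of y]] by simp
  qed
  then show ?thesis
    using self_adjointD(3)[OF assms(1)] by blast
qed

text \<open>Symmetry of \<open>T'\<close>, tested only against the domain of \<open>T\<close>, puts
  every pair of the graph of \<open>T'\<close> into that of the adjoint of \<open>T\<close>.\<close>

lemma self_adjoint_maximal:
  assumes "self_adjoint T" "self_adjoint T'" "T \<subseteq>\<^sub>m T'"
  shows "T = T'"
proof -
  have sub: "T' y = Some v" if "T y = Some v" for y v
    using assms(3) that unfolding map_le_def by (metis domI)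
  have "T x = Some z" if "T' x = Some z" for x z
    using self_adjointD(3)[OF assms(1)] self_adjoint_symmetric[OF assms(2) that] sub by blast
  with sub have "T x = Some z \<longleftrightarrow> T' x = Some z" for x z
    by blast
  then show ?thesis
    by (metis ext option.exhaust)
qed

text \<open>\<open>bounded_op\<close> is an estimate on the domain only. It sends a sequence in the
  domain that converges to \<open>x\<close> to a Cauchy sequence, and closedness then puts
  \<open>x\<close> in the domain.\<close>

lemma self_adjoint_bounded_total:
  assumes "self_adjoint T" "bounded_op T"
  shows "dom T = UNIV"
proof -
  obtain K where K: "\<And>x. x \<in> dom T \<Longrightarrow> norm (the (T x)) \<le> K * norm x"
    using assms(2) by (auto simp: bounded_op_def)
  have "x \<in> dom T" for x
  proof -
    have "x \<in> closure (dom T)"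
      using self_adjointD(2)[OF assms(1)] by (simp add: densely_defined_def)
    then obtain f where f: "\<And>n. f n \<in> dom T" "f \<longlonglongrightarrow> x"
      by (auto simp: closure_sequential)
    define g where "g n = the (T (f n))" for n
    have g: "T (f n) = Some (g n)" for n
      using f(1)[of n] by (auto simp: g_def)
    have "Cauchy g"
    proof (rule metric_CauchyI)
      fix e :: real assume "e > 0"
      moreover have "Cauchy f"
        using f(2) by (rule LIMSEQ_imp_Cauchy)
      ultimately obtain M where M: "\<And>m n. m \<ge> M \<Longrightarrow> n \<ge> M \<Longrightarrow> dist (f m) (f n) < e / (\<bar>K\<bar> + 1)"
        by (metis metric_CauchyD abs_ge_zero add_nonneg_pos divide_pos_pos zero_less_one)
      have "dist (g m) (g n) < e" if "m \<ge> M" "n \<ge> M" for m n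
      proof -
        have "T (f m - f n) = Some (g m - g n)"
          using linear_operatorD(4)[OF self_adjointD(1)[OF assms(1)] g g] .
        then have "norm (g m - g n) \<le> K * norm (f m - f n)"
          using K[of "f m - f n"] by (simp add: domI)
        also have "\<dots> \<le> (\<bar>K\<bar> + 1) * norm (f m - f n)"
          by (intro mult_right_mono) auto
        also have "\<dots> < (\<bar>K\<bar> + 1) * (e / (\<bar>K\<bar> + 1))"
          using M[OF that] by (intro mult_strict_left_mono) (auto simp: dist_norm)
        finally show ?thesis
          by (simp add: dist_norm)
      qed
      then show "\<exists>M. \<forall>m\<ge>M. \<forall>n\<ge>M. dist (g m) (g n) < e"
        by blast
    qed
    then obtain u where "g \<longlonglongrightarrow> u"
      using Cauchy_convergent convergent_def by blast
    with f(2) have "T x = Some u"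
      by (rule self_adjoint_closed[OF assms(1) g])
    then show ?thesis
      by blast
  qed
  then show ?thesis
    by blast
qed

section \<open>Everywhere defined symmetric maps and their inverses\<close>

text \<open>Symmetry moves \<open>F\<close> to the other slot, where the inner product supplies
  additivity and homogeneity. Inverses obtained pointwise are thus linear as soon as they are
  symmetric.\<close>

lemma symmetric_linear:
  fixes F :: "'a::complex_hilbert \<Rightarrow> 'a"
  assumes "\<And>x y. cinner (F x) y = cinner x (F y)"
  shows "F (x + y) = F x + F y" "F (c *\<^sub>C x) = c *\<^sub>C F x" "F (r *\<^sub>R x) = r *\<^sub>R F x"
proof -
  show "F (x + y) = F x + F y"
    by (rule cinner_eq_imp_eq) (simp add: assms cinner_add_left)
  show *: "F (c *\<^sub>C x) = c *\<^sub>C F x" for c x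
    by (rule cinner_eq_imp_eq) (simp add: assms cinner_scaleC_left)
  show "F (r *\<^sub>R x) = r *\<^sub>R F x"
    using *[of "of_real r" x] by (simp add: scaleC_of_real)
qed

text \<open>The relation between \<open>T\<close> and \<open>F\<close> contains the injectivity of
  \<open>F\<close>. A vector orthogonal to the range of \<open>F\<close> is annihilated by
  \<open>F\<close>, hence zero, so \<open>T\<close> is densely defined; and
  \<open>cinner x v = cinner z (F v)\<close> for all \<open>v\<close> says exactly
  \<open>F z = x\<close>.\<close>

lemma inverse_symmetric_self_adjoint:
  fixes F :: "'a::complex_hilbert \<Rightarrow> 'a"
  assumes T: "\<And>x y. T y = Some x \<longleftrightarrow> F x = y"
    and sym: "\<And>x y. cinner (F x) y = cinner x (F y)"
  shows "self_adjoint T"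
proof -
  note lin = symmetric_linear[OF sym]
  have dom: "dom T = range F"
    by (auto simp: dom_def T)
  have F0: "F 0 = 0"
    using lin(2)[of 0 0] by simp
  then have "T 0 = Some 0"
    using T by simp
  have csub: "csubspace (dom T)"
    using rangeI[of F 0, unfolded F0] by (auto simp: csubspace_def dom simp flip: lin(1,2))
  have the_T: "the (T (F x)) = x" for x
    using T[of "F x" x] by simp
  have "linear_operator T"
    unfolding linear_operator_def using csub by (auto simp: dom the_T simp flip: lin(1,2))
  have dense: "densely_defined T"
    unfolding densely_defined_def
  proof (rule csubspace_dense_if_no_orthogonal[OF csub])
    fix z assume "\<And>y. y \<in> dom T \<Longrightarrow> cinner z y = 0"
    then have "cinner (F z) y = cinner 0 y" for y
      by (simp add: dom sym cinner.zero_left)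
    then have "F z = 0"
      by (rule cinner_eq_imp_eq)
    then show "z = 0"
      using T[of 0 z] \<open>T 0 = Some 0\<close> by simp
  qed
  have "adjoint_op T x = Some z \<longleftrightarrow> T x = Some z" for x z
  proof -
    have "adjoint_op T x = Some z \<longleftrightarrow> (\<forall>v. cinner x v = cinner z (F v))"
      unfolding adjoint_op_eq_Some_iff[OF dense] T by auto
    also have "\<dots> \<longleftrightarrow> F z = x"
      using cinner_eq_imp_eq[of x "F z"] by (auto simp: sym)
    finally show ?thesis
      by (simp add: T)
  qed
  then have "adjoint_op T = T"
    by (metis ext option.exhaust)
  then show ?thesis
    by (simp add: self_adjoint_def dense \<open>linear_operator T\<close>)
qed

section \<open>Spectrum of a self-adjoint operator\<close>

lemma resolvent_set_iff:
  "z \<in> resolvent_set T \<longleftrightarrow> bij_betw (\<lambda>x. the (T x) - z *\<^sub>C x) (dom T) UNIV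
    \<and> (\<exists>K. \<forall>x\<in>dom T. norm x \<le> K * norm (the (T x) - z *\<^sub>C x))"
proof -
  have "dom (shift_op T z) = dom T"
    by (auto simp: shift_op_def dom_def)
  moreover have "the (shift_op T z x) = the (T x) - z *\<^sub>C x" if "x \<in> dom T" for x
    using that by (auto simp: shift_op_def)
  moreover from this have "bij_betw (\<lambda>x. the (shift_op T z x)) (dom T) UNIV
      \<longleftrightarrow> bij_betw (\<lambda>x. the (T x) - z *\<^sub>C x) (dom T) UNIV"
    by (rule bij_betw_cong)
  ultimately show ?thesis
    by (simp add: resolvent_set_def has_bounded_inverse_def)
qed

lemma has_bounded_inverse_iff_0_resolvent: "has_bounded_inverse T \<longleftrightarrow> 0 \<in> resolvent_set T"
proof -
  have "shift_op T 0 = T"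
    by (rule ext) (simp add: shift_op_def option.map_ident)
  then show ?thesis
    by (simp add: resolvent_set_def)
qed

text \<open>The range of \<open>T - z\<close> is closed because \<open>T - z\<close> is bounded below and \<open>T\<close> is closed, and it
  is dense because its orthogonal complement is the kernel of \<open>T - cnj z\<close>.\<close>

lemma resolvent_setI:
  fixes T :: "'a::complex_hilbert \<rightharpoonup> 'a"
  assumes sa: "self_adjoint T" and "k > 0"
    and below: "\<And>x u. T x = Some u \<Longrightarrow> k * norm x \<le> norm (u - z *\<^sub>C x)"
    and ker: "\<And>x. T x = Some (cnj z *\<^sub>C x) \<Longrightarrow> x = 0"
  shows "z \<in> resolvent_set T"
proof -
  define f where "f x = the (T x) - z *\<^sub>C x" for x
  have fI: "f x = u - z *\<^sub>C x" if "T x = Some u" for x u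
    using that by (simp add: f_def)
  note lin = linear_operatorD[OF self_adjointD(1)[OF sa]]
  have csub: "csubspace (dom T)"
    using self_adjointD(1)[OF sa] by (simp add: linear_operator_def)
  have bound: "norm x \<le> 1 / k * norm (f x)" if "x \<in> dom T" for x
    using that below[of x] \<open>k > 0\<close> by (auto simp: fI field_simps)
  have fdiff: "f (x - y) = f x - f y" "x - y \<in> dom T" if xy: "x \<in> dom T" "y \<in> dom T" for x y
  proof -
    obtain u v where uv: "T x = Some u" "T y = Some v"
      using xy by blast
    then show "f (x - y) = f x - f y" "x - y \<in> dom T"
      using lin(4)[OF uv] by (auto simp: fI scaleC_diff_right)
  qed
  have inj: "inj_on f (dom T)"
  proof (rule inj_onI)
    fix x y assume "x \<in> dom T" "y \<in> dom T" "f x = f y"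
    then show "x = y"
      using bound[of "x - y"] fdiff[of x y] by simp
  qed
  have csubR: "csubspace (f ` dom T)"
    unfolding csubspace_def
  proof (intro conjI ballI allI)
    have "0 \<in> dom T"
      using csubspaceD(1)[OF csub] .
    then have "T 0 = Some 0"
      using lin(3) by blast
    then have "f 0 = 0"
      by (simp add: fI)
    then show "0 \<in> f ` dom T"
      using \<open>0 \<in> dom T\<close> by (metis imageI)
  next
    fix a b assume "a \<in> f ` dom T" "b \<in> f ` dom T"
    then obtain x u y v where xy: "T x = Some u" "T y = Some v" "a = f x" "b = f y"
      by auto
    have "a + b = f (x + y)"
      using lin(1)[OF xy(1,2)] xy by (simp add: fI scaleC_add_right)
    then show "a + b \<in> f ` dom T"
      using lin(1)[OF xy(1,2)] by blast
  next
    fix c a assume "a \<in> f ` dom T"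
    then obtain x u where xu: "T x = Some u" "a = f x"
      by auto
    have "c *\<^sub>C a = f (c *\<^sub>C x)"
      using lin(2)[OF xu(1,1)] xu by (simp add: fI scaleC_diff_right scaleC_scaleC mult.commute)
    then show "c *\<^sub>C a \<in> f ` dom T"
      using lin(2)[OF xu(1,1)] by blast
  qed
  have "closure (f ` dom T) = UNIV"
  proof (rule csubspace_dense_if_no_orthogonal[OF csubR])
    fix w assume w: "\<And>y. y \<in> f ` dom T \<Longrightarrow> cinner w y = 0"
    have "cinner w v = cinner (cnj z *\<^sub>C w) y" if "T y = Some v" for y v
      using w[OF imageI, of y] domI[of T, OF that] fI[OF that]
      by (simp add: cinner.diff_right cinner_scaleC_right cinner_scaleC_left)
    then show "w = 0"
      by (intro ker) (use self_adjointD(3)[OF sa] in blast)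
  qed
  moreover have "closure (f ` dom T) \<subseteq> f ` dom T"
  proof
    fix v assume "v \<in> closure (f ` dom T)"
    then obtain g where g: "\<And>n. g n \<in> f ` dom T" "g \<longlonglongrightarrow> v"
      by (auto simp: closure_sequential)
    from g(1) have "\<forall>n. \<exists>x. x \<in> dom T \<and> g n = f x"
      by blast
    then obtain h where h: "\<And>n. h n \<in> dom T" "\<And>n. g n = f (h n)"
      using choice[of "\<lambda>n x. x \<in> dom T \<and> g n = f x"] by blast
    have "Cauchy h"
    proof (rule metric_CauchyI)
      fix e :: real assume "e > 0"
      moreover have "Cauchy g"
        using g(2) by (rule LIMSEQ_imp_Cauchy)
      ultimately obtain M where M: "\<And>m n. m \<ge> M \<Longrightarrow> n \<ge> M \<Longrightarrow> dist (g m) (g n) < k * e"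
        using metric_CauchyD[of g "k * e"] \<open>k > 0\<close> by auto
      have "dist (h m) (h n) < e" if "m \<ge> M" "n \<ge> M" for m n
      proof -
        have "f (h m - h n) = g m - g n"
          using fdiff(1) h by simp
        then have "norm (h m - h n) \<le> 1 / k * norm (g m - g n)"
          using bound[of "h m - h n"] fdiff(2) h(1) by simp
        then have "k * norm (h m - h n) \<le> norm (g m - g n)"
          using \<open>k > 0\<close> by (simp add: field_simps)
        also have "\<dots> < k * e"
          using M[OF that] by (simp add: dist_norm)
        finally show ?thesis
          using \<open>k > 0\<close> by (simp add: dist_norm)
      qed
      then show "\<exists>M. \<forall>m\<ge>M. \<forall>n\<ge>M. dist (h m) (h n) < e"
        by blast
    qed
    then obtain x where x: "h \<longlonglongrightarrow> x"
      using Cauchy_convergent convergent_def by blast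
    have Th: "T (h n) = Some (g n + z *\<^sub>C h n)" for n
      using h(1)[of n] by (auto simp: h(2) fI)
    have "(\<lambda>n. g n + z *\<^sub>C h n) \<longlonglongrightarrow> v + z *\<^sub>C x"
      by (intro tendsto_add g(2) bounded_linear.tendsto[OF bounded_linear_scaleC] x)
    then have "T x = Some (v + z *\<^sub>C x)"
      by (rule self_adjoint_closed[OF sa Th x])
    then show "v \<in> f ` dom T"
      by (auto intro!: rev_image_eqI[of x] simp: fI)
  qed
  ultimately have "bij_betw f (dom T) UNIV"
    using inj by (auto simp: bij_betw_def)
  then show ?thesis
    unfolding resolvent_set_iff f_def[symmetric] using bound by blast
qed

text \<open>A real \<open>s\<close> equals its conjugate, so the lower bound also excludes the
  kernel that obstructs a dense range.\<close>

lemma resolvent_set_realI: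
  assumes "self_adjoint T" "k > 0"
    and "\<And>x u. T x = Some u \<Longrightarrow> k * norm x \<le> norm (u - s *\<^sub>R x)"
  shows "complex_of_real s \<in> resolvent_set T"
proof (rule resolvent_setI[OF assms(1,2)])
  show "k * norm x \<le> norm (u - complex_of_real s *\<^sub>C x)" if "T x = Some u" for x u
    using assms(3)[OF that] by (simp add: scaleC_of_real)
  show "x = 0" if "T x = Some (cnj (complex_of_real s) *\<^sub>C x)" for x
    using assms(3)[OF that] \<open>k > 0\<close> by (simp add: scaleC_of_real mult_le_0_iff)
qed

lemma self_adjoint_spectrum_real:
  assumes sa: "self_adjoint T" and "z \<in> spectrum_op T"
  shows "Im z = 0"
proof (rule ccontr)
  assume Im: "Im z \<noteq> 0"
  \<comment> \<open>Since \<open>cinner x u\<close> is real, the imaginary part of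
    \<open>cinner x (u - w x)\<close> comes from \<open>w\<close> alone. The bound is kept general
    in \<open>w\<close> because it is applied to both \<open>z\<close> and
    \<open>cnj z\<close>.\<close>
  have below: "\<bar>Im w\<bar> * norm x \<le> norm (u - w *\<^sub>C x)" if xu: "T x = Some u" for w x u
  proof (cases "x = 0")
    case False
    have "cnj (cinner x u) = cinner x u"
      by (metis self_adjoint_symmetric[OF sa xu xu] cinner_commute)
    then have "Im (cinner x u) = 0"
      by (metis Reals_cnj_iff complex_is_Real_iff)
    then have eq: "\<bar>Im (cinner x (u - w *\<^sub>C x))\<bar> = \<bar>Im w\<bar> * norm x * norm x"
      by (simp add: cinner.diff_right cinner_scaleC_right cinner_self abs_mult power2_eq_square)
    have "\<bar>Im (cinner x (u - w *\<^sub>C x))\<bar> \<le> norm x * norm (u - w *\<^sub>C x)"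
      using abs_Im_le_cmod norm_cinner_le order_trans by blast
    then have "(\<bar>Im w\<bar> * norm x) * norm x \<le> norm (u - w *\<^sub>C x) * norm x"
      unfolding eq by (simp only: mult.commute[of "norm x" "norm (u - w *\<^sub>C x)"])
    then show ?thesis
      using False by simp
  qed simp
  have "z \<in> resolvent_set T"
  proof (rule resolvent_setI[OF sa, of "\<bar>Im z\<bar>"])
    show "x = 0" if "T x = Some (cnj z *\<^sub>C x)" for x
      using below[OF that, of "cnj z"] Im by (simp add: mult_le_0_iff)
  qed (use Im below in auto)
  with assms(2) show False
    by (simp add: spectrum_op_def)
qed


text \<open>The single equivalence for \<open>G\<close> records both the domain and the values of
  \<open>T\<close>, so later arguments can work with bounded operators instead of partial
  maps.\<close>

lemma resolvent_real_inverse: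
  fixes T :: "'a::complex_hilbert \<rightharpoonup> 'a"
  assumes sa: "self_adjoint T" and res: "complex_of_real s \<in> resolvent_set T"
  obtains G :: "'a \<Rightarrow>\<^sub>L 'a" where
    "\<And>x y. T y = Some (x + s *\<^sub>R y) \<longleftrightarrow> G x = y"
    "\<And>x y. cinner (G x) y = cinner x (G y)"
proof -
  define f where "f x = the (T x) - s *\<^sub>R x" for x
  have bij: "bij_betw f (dom T) UNIV" and "\<exists>K. \<forall>x\<in>dom T. norm x \<le> K * norm (f x)"
    using res by (simp_all add: resolvent_set_iff scaleC_of_real f_def[abs_def])
  then obtain K where K: "\<And>x. x \<in> dom T \<Longrightarrow> norm x \<le> K * norm (f x)"
    by blast
  define g where "g = the_inv_into (dom T) f"
  have gT: "g x \<in> dom T" and fg: "f (g x) = x" for x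
    using the_inv_into_into[of f "dom T" x "dom T"] f_the_inv_into_f_bij_betw[OF bij, of x] bij
    by (auto simp: g_def bij_betw_def)
  have T_g: "T (g x) = Some (x + s *\<^sub>R g x)" for x
    using gT[of x] fg[of x] by (auto simp: f_def diff_eq_eq)
  have g_eq: "g x = y" if "T y = Some (x + s *\<^sub>R y)" for x y
    using that the_inv_into_f_f[of f "dom T" y] bij
    by (auto simp: g_def f_def bij_betw_def)
  have sym: "cinner (g x) y = cinner x (g y)" for x y
    using self_adjoint_symmetric[OF sa T_g[of x] T_g[of y]]
    by (simp add: cinner_add_left cinner_add_right cinner_scaleR_left cinner_scaleR_right)
  have "bounded_linear g"
  proof (rule bounded_linear_intro[where K = K])
    show "norm (g x) \<le> norm x * K" for x
      using K[OF gT[of x]] by (simp add: fg mult.commute)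
  qed (rule symmetric_linear[OF sym])+
  then have "blinfun_apply (Blinfun g) = g"
    by (rule bounded_linear_Blinfun_apply)
  then show thesis
    using that[of "Blinfun g"] sym g_eq T_g by metis
qed

text \<open>With \<open>G = (T - s)\<^bsup>-1\<^esup>\<close> and \<open>M\<close> its norm, \<open>M\<^sup>2 - G\<^sup>2\<close> is small on vectors that almost
  attain the norm, so \<open>G - M\<close> and \<open>G + M\<close> are not both bounded below.\<close>

lemma spectrum_at_resolvent_norm:
  fixes T :: "'a::complex_hilbert \<rightharpoonup> 'a"
  assumes sa: "self_adjoint T" and res: "complex_of_real s \<in> resolvent_set T"
    and nontriv: "\<exists>x::'a. x \<noteq> 0"
  obtains M where "M > 0" "\<And>x u. T x = Some u \<Longrightarrow> norm x \<le> M * norm (u - s *\<^sub>R x)"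
    "complex_of_real (s + 1 / M) \<in> spectrum_op T \<or> complex_of_real (s - 1 / M) \<in> spectrum_op T"
proof -
  obtain G :: "'a \<Rightarrow>\<^sub>L 'a" where G: "\<And>x y. T y = Some (x + s *\<^sub>R y) \<longleftrightarrow> G x = y"
    and sym: "\<And>x y. cinner (G x) y = cinner x (G y)"
    using resolvent_real_inverse[OF sa res] by metis
  define M where "M = norm G"
  have T0: "T 0 = Some 0"
    using G[of 0 0] by (simp add: blinfun.zero_right)
  have GM: "norm (G x) \<le> M * norm x" for x
    unfolding M_def by (rule norm_blinfun)
  have "M > 0"
  proof (rule ccontr)
    assume "\<not> M > 0"
    then have G0: "G x = 0" for x
      using GM[of x] by (simp add: M_def)
    obtain x :: 'a where "x \<noteq> 0"
      using nontriv by blast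
    then show False
      using G[of 0 x] T0 G0[of x] by simp
  qed
  have "norm x \<le> M * norm (u - s *\<^sub>R x)" if "T x = Some u" for x u
  proof -
    have "G (u - s *\<^sub>R x) = x"
      using G[of x "u - s *\<^sub>R x"] that by simp
    then show ?thesis
      using GM by metis
  qed
  moreover have "False"
    if res': "complex_of_real (s + 1 / M) \<in> resolvent_set T" "complex_of_real (s - 1 / M) \<in> resolvent_set T"
  proof -
    \<comment> \<open>Applying \<open>T - s - e\<close> to \<open>G x\<close> gives
      \<open>x - e G x\<close>, so the resolvent \<open>E\<close> at \<open>s + e\<close> recovers
      \<open>G x\<close> from a multiple of \<open>G x - x / e\<close>. With
      \<open>e = \<plusminus> 1 / M\<close> this bounds \<open>G - M\<close> and
      \<open>G + M\<close> from below.\<close>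
    have below: "\<exists>k>0. \<forall>x. k * norm (G x) \<le> norm (G x - (1 / e) *\<^sub>R x)"
      if e: "complex_of_real (s + e) \<in> resolvent_set T" "e \<noteq> 0" for e
    proof -
      obtain E :: "'a \<Rightarrow>\<^sub>L 'a" where E: "\<And>x y. T y = Some (x + (s + e) *\<^sub>R y) \<longleftrightarrow> E x = y"
        using resolvent_real_inverse[OF sa e(1)] by metis
      have "1 / (\<bar>e\<bar> * (norm E + 1)) * norm (G x) \<le> norm (G x - (1 / e) *\<^sub>R x)" for x
      proof -
        have "T (G x) = Some (x + s *\<^sub>R G x)"
          using G by blast
        then have "E (x - e *\<^sub>R G x) = G x"
          using E[of "G x" "x - e *\<^sub>R G x"] by (simp add: algebra_simps)
        then have "norm (G x) \<le> norm E * norm (x - e *\<^sub>R G x)"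
          by (metis norm_blinfun)
        also have "\<dots> \<le> (norm E + 1) * norm (x - e *\<^sub>R G x)"
          by (intro mult_right_mono) auto
        also have "x - e *\<^sub>R G x = (- e) *\<^sub>R (G x - (1 / e) *\<^sub>R x)"
          using e(2) by (simp add: algebra_simps)
        also have "norm \<dots> = \<bar>e\<bar> * norm (G x - (1 / e) *\<^sub>R x)"
          by simp
        finally show ?thesis
          using e(2) by (simp add: divide_le_eq mult_ac add_nonneg_pos)
      qed
      moreover have "1 / (\<bar>e\<bar> * (norm E + 1)) > 0"
        using e(2) by (simp add: add_nonneg_pos)
      ultimately show ?thesis
        by blast
    qed
    obtain k k' where k: "k > 0" "\<And>x. k * norm (G x) \<le> norm (G x - M *\<^sub>R x)"
      and k': "k' > 0" "\<And>x. k' * norm (G x) \<le> norm (G x + M *\<^sub>R x)"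
      using below[of "1 / M"] below[of "- 1 / M"] res' \<open>M > 0\<close> by auto
    define q where "q = (k * k')\<^sup>2"
    have "q > 0"
      using k(1) k'(1) by (simp add: q_def)
    \<comment> \<open>The factorization \<open>(G - M) (G + M) = G^2 - M^2\<close> combines the two
      lower bounds: one is applied at \<open>w = G x + M x\<close>, the other at \<open>G x\<close>.
      Squaring and expanding gives the claim.\<close>
    have key: "M\<^sup>2 * (norm (G x))\<^sup>2 + q * (norm (G (G x)))\<^sup>2 \<le> M ^ 4 * (norm x)\<^sup>2" for x
    proof -
      define w where "w = G x + M *\<^sub>R x"
      have GG: "G w - M *\<^sub>R w = G (G x) - (M\<^sup>2) *\<^sub>R x"
        by (simp add: w_def blinfun.add_right blinfun.scaleR_right algebra_simps power2_eq_square)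
      have "G w = G (G x) + M *\<^sub>R G x"
        by (simp add: w_def blinfun.add_right blinfun.scaleR_right)
      then have "k * (k' * norm (G (G x))) \<le> norm (G (G x) - (M\<^sup>2) *\<^sub>R x)"
        using k'(2)[of "G x"] k(2)[of w] k(1) unfolding GG
        by (metis mult_le_cancel_left_pos order_trans)
      then have "(k * k' * norm (G (G x)))\<^sup>2 \<le> (norm (G (G x) - (M\<^sup>2) *\<^sub>R x))\<^sup>2"
        using k(1) k'(1) by (intro power_mono) auto
      also have "\<dots> = (norm (G (G x)))\<^sup>2 - 2 * M\<^sup>2 * (norm (G x))\<^sup>2 + M ^ 4 * (norm x)\<^sup>2"
        using norm_add_sq[of "G (G x)" "- (M\<^sup>2 *\<^sub>R x)"] cinner_self[of "G x"]
        by (simp add: cinner.minus_right cinner_scaleR_right sym power_mult_distrib flip: power_mult)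
      also have "(norm (G (G x)))\<^sup>2 \<le> (M * norm (G x))\<^sup>2"
        by (intro power_mono GM) auto
      finally show ?thesis
        by (simp add: q_def power_mult_distrib)
    qed
    have t_sq: "(norm (G x))\<^sup>2 * (norm (G x))\<^sup>2 \<le> (norm x)\<^sup>2 * (norm (G (G x)))\<^sup>2" for x
    proof -
      have "(norm (G x))\<^sup>2 = norm (cinner x (G (G x)))"
        using cinner_self[of "G x"] by (simp add: sym norm_power)
      also have "\<dots> \<le> norm x * norm (G (G x))"
        by (rule norm_cinner_le)
      finally have "(norm (G x))\<^sup>2 * (norm (G x))\<^sup>2 \<le> (norm x * norm (G (G x))) * (norm x * norm (G (G x)))"
        by (intro mult_mono) auto
      then show ?thesis
        by (simp add: power2_eq_square mult_ac)
    qed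
    \<comment> \<open>A factor below 1 that improves the norm bound of \<open>G\<close>. Where
      \<open>(norm (G x))^2\<close> is at most half of \<open>M^2 (norm x)^2\<close>, the entry
      \<open>1 / 2\<close> suffices; elsewhere \<open>t_sq\<close> keeps \<open>G (G x)\<close>
      large, and \<open>key\<close> yields the factor \<open>1 / (1 + q / 2)\<close>. This
      contradicts the minimality of the operator norm \<open>M\<close>.\<close>
    define \<theta> where "\<theta> = max (1 / 2) (1 / (1 + q / 2))"
    have \<theta>: "0 < \<theta>" "\<theta> < 1" "1 / 2 \<le> \<theta>" "1 \<le> \<theta> * (1 + q / 2)"
      using \<open>q > 0\<close> by (auto simp: \<theta>_def divide_simps max_def)
    have "(norm (G x))\<^sup>2 \<le> \<theta> * M\<^sup>2 * (norm x)\<^sup>2" for x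
    proof -
      define t n where "t = (norm (G x))\<^sup>2" and "n = (norm x)\<^sup>2"
      have "t \<ge> 0" "n \<ge> 0"
        by (simp_all add: t_def n_def)
      have "t \<le> \<theta> * M\<^sup>2 * n"
      proof (cases "t \<le> 1 / 2 * (M\<^sup>2 * n)")
        case True
        also have "1 / 2 * (M\<^sup>2 * n) \<le> \<theta> * (M\<^sup>2 * n)"
          using \<theta>(3) \<open>n \<ge> 0\<close> by (intro mult_right_mono) auto
        finally show ?thesis
          by (simp add: mult.assoc)
      next
        case False
        have "n > 0"
        proof (rule ccontr)
          assume "\<not> n > 0"
          then have "x = 0"
            by (simp add: n_def)
          then show False
            using False by (simp add: t_def n_def blinfun.zero_right)
        qed
        have "q * (t * t) \<le> q * (n * (norm (G (G x)))\<^sup>2)"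
          using t_sq[of x] \<open>q > 0\<close> by (intro mult_left_mono) (auto simp: t_def n_def)
        then have "M\<^sup>2 * t * n + q * (t * t) \<le> n * (M\<^sup>2 * t + q * (norm (G (G x)))\<^sup>2)"
          by (simp add: algebra_simps)
        also have "\<dots> \<le> n * (M ^ 4 * n)"
          using key[of x] \<open>n \<ge> 0\<close> by (intro mult_left_mono) (auto simp: t_def n_def)
        finally have "M\<^sup>2 * t * n + q * (t * t) \<le> n * (M ^ 4 * n)" .
        moreover have "(q * t) * (1 / 2 * (M\<^sup>2 * n)) \<le> (q * t) * t"
          using False \<open>q > 0\<close> \<open>t \<ge> 0\<close> by (intro mult_left_mono) auto
        ultimately have "(M\<^sup>2 * n) * ((1 + q / 2) * t) \<le> (M\<^sup>2 * n) * (M\<^sup>2 * n)"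
          by (simp add: algebra_simps power_numeral_reduce)
        then have "(1 + q / 2) * t \<le> M\<^sup>2 * n"
          using \<open>n > 0\<close> \<open>M > 0\<close> by (simp only: mult_le_cancel_left_pos mult_pos_pos zero_less_power)
        then have "\<theta> * ((1 + q / 2) * t) \<le> \<theta> * (M\<^sup>2 * n)"
          using \<theta>(1) by (intro mult_left_mono) auto
        moreover have "1 * t \<le> (\<theta> * (1 + q / 2)) * t"
          using \<theta>(4) \<open>t \<ge> 0\<close> by (intro mult_right_mono) auto
        ultimately show ?thesis
          by (simp add: mult.assoc)
      qed
      then show ?thesis
        by (simp add: t_def n_def)
    qed
    then have "(norm (G x))\<^sup>2 \<le> (sqrt \<theta> * M * norm x)\<^sup>2" for x
      using \<theta>(1) by (simp add: power_mult_distrib)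
    then have "norm (G x) \<le> sqrt \<theta> * M * norm x" for x
      by (rule power2_le_imp_le) (use \<open>M > 0\<close> \<theta>(1) in simp)
    then have "M \<le> sqrt \<theta> * M"
      unfolding M_def by (intro norm_blinfun_bound) (use \<theta>(1) in simp_all)
    moreover have "sqrt \<theta> < 1"
      using \<theta> by simp
    ultimately show False
      using \<open>M > 0\<close> by simp
  qed
  ultimately show thesis
    using that[of M] \<open>M > 0\<close> unfolding spectrum_op_def by blast
qed

section \<open>From the location of the spectrum to lower bounds\<close>

text \<open>One of \<open>s \<plusminus> 1 / M\<close> is in the spectrum and hence outside the gap,
  so \<open>1 / M\<close> is at least \<open>d\<close>. On the zero space both sides vanish.\<close>

lemma self_adjoint_bounded_below_gap:
  fixes T :: "'a::complex_hilbert \<rightharpoonup> 'a"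
  assumes sa: "self_adjoint T" and "d > 0"
    and gap: "\<And>r. \<bar>r - s\<bar> < d \<Longrightarrow> complex_of_real r \<in> resolvent_set T"
    and "T x = Some u"
  shows "d * norm x \<le> norm (u - s *\<^sub>R x)"
proof (cases "\<exists>x::'a. x \<noteq> 0")
  case True
  have "complex_of_real s \<in> resolvent_set T"
    using gap[of s] \<open>d > 0\<close> by simp
  then obtain M where M: "M > 0" "\<And>x u. T x = Some u \<Longrightarrow> norm x \<le> M * norm (u - s *\<^sub>R x)"
    "complex_of_real (s + 1 / M) \<in> spectrum_op T \<or> complex_of_real (s - 1 / M) \<in> spectrum_op T"
    using spectrum_at_resolvent_norm[OF sa _ True] by metis
  have "\<not> 1 / M < d"
    using gap[of "s + 1 / M"] gap[of "s - 1 / M"] M(1,3) by (auto simp: spectrum_op_def)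
  then have "d * M \<le> 1"
    using M(1) by (simp add: divide_less_eq)
  have "d * norm x \<le> d * (M * norm (u - s *\<^sub>R x))"
    using M(2)[OF assms(4)] \<open>d > 0\<close> by simp
  also have "\<dots> \<le> norm (u - s *\<^sub>R x)"
    using mult_right_mono[OF \<open>d * M \<le> 1\<close> norm_ge_zero[of "u - s *\<^sub>R x"]] by (simp add: mult.assoc)
  finally show ?thesis .
next
  case False
  then show ?thesis
    by (metis norm_zero mult_zero_right norm_ge_zero)
qed


text \<open>The gap bound at \<open>s = - n\<close> reads
  \<open>(a + n) norm x \<le> norm (u + n x)\<close>. After squaring, the terms in
  \<open>n^2\<close> cancel and the terms linear in \<open>n\<close> compare
  \<open>a (norm x)^2\<close> with the quadratic form; a large \<open>n\<close> decides.\<close>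

lemma self_adjoint_lower_bound:
  assumes sa: "self_adjoint T" and res: "\<And>r. r < a \<Longrightarrow> complex_of_real r \<in> resolvent_set T"
    and xu: "T x = Some u"
  shows "a * (norm x)\<^sup>2 \<le> Re (cinner x u)"
proof (rule ccontr)
  define p where "p = a * (norm x)\<^sup>2 - Re (cinner x u)"
  assume "\<not> ?thesis"
  then have "p > 0"
    by (simp add: p_def)
  \<comment> \<open>The part \<open>\<bar>a\<bar> + 1\<close> makes the radius \<open>a + n\<close>
    positive; the last part makes \<open>n * p\<close> exceed \<open>(norm u)^2\<close>.\<close>
  define n where "n = \<bar>a\<bar> + 1 + (norm u)\<^sup>2 / p"
  have "(norm u)\<^sup>2 / p \<ge> 0"
    using \<open>p > 0\<close> by simp
  then have "a + n > 0"
    by (simp add: n_def)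
  have "(a + n) * norm x \<le> norm (u - (- n) *\<^sub>R x)"
    using self_adjoint_bounded_below_gap[OF sa \<open>a + n > 0\<close> _ xu, of "- n"] res by simp
  then have "((a + n) * norm x)\<^sup>2 \<le> (norm (u + n *\<^sub>R x))\<^sup>2"
    using \<open>a + n > 0\<close> by (intro power_mono) auto
  also have "\<dots> = (norm u)\<^sup>2 + 2 * n * Re (cinner x u) + n\<^sup>2 * (norm x)\<^sup>2"
    using norm_add_sq[of u "n *\<^sub>R x"] cinner_commute[of u x]
    by (simp add: cinner_scaleR_right power_mult_distrib)
  finally have "a\<^sup>2 * (norm x)\<^sup>2 + 2 * n * p \<le> (norm u)\<^sup>2"
    by (simp add: p_def power2_eq_square algebra_simps)
  then have "2 * n * p \<le> (norm u)\<^sup>2"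
    by (smt (verit) zero_le_mult_iff zero_le_power2)
  moreover have "n * p = (\<bar>a\<bar> + 1) * p + (norm u)\<^sup>2"
    using \<open>p > 0\<close> by (simp add: n_def algebra_simps)
  moreover have "(\<bar>a\<bar> + 1) * p > 0"
    using \<open>p > 0\<close> by simp
  ultimately show False
    using zero_le_power2[of "norm u"] unfolding mult.assoc by linarith
qed

lemma resolvent_below_inf_spec:
  assumes "ereal r < inf_spec T"
  shows "complex_of_real r \<in> resolvent_set T"
proof (rule ccontr)
  assume "complex_of_real r \<notin> resolvent_set T"
  then have "inf_spec T \<le> ereal (Re (complex_of_real r))"
    unfolding inf_spec_def spectrum_op_def by (intro INF_lower) auto
  with assms show False
    by simp
qed

text \<open>At \<open>s = 0\<close> one of \<open>\<plusminus> 1 / M\<close> is in the spectrum, and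
  the negative one lies below the infimum. Conversely \<open>norm (A x) \<ge> norm x / M\<close>
  leaves no spectrum between 0 and \<open>1 / M\<close>. The zero space is excluded since its
  spectrum is empty.\<close>

lemma inf_spec_attained:
  fixes A :: "'a::complex_hilbert \<rightharpoonup> 'a"
  assumes sa: "self_adjoint A" and pos: "inf_spec A > 0" and nontriv: "\<exists>x::'a. x \<noteq> 0"
  obtains a where "a > 0" "inf_spec A = ereal a" "complex_of_real a \<in> spectrum_op A"
proof -
  have "complex_of_real 0 \<in> resolvent_set A"
    using pos by (intro resolvent_below_inf_spec) (simp add: zero_ereal_def)
  then obtain M where M: "M > 0" "\<And>x u. A x = Some u \<Longrightarrow> norm x \<le> M * norm (u - 0 *\<^sub>R x)"
    "complex_of_real (0 + 1 / M) \<in> spectrum_op A \<or> complex_of_real (0 - 1 / M) \<in> spectrum_op A"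
    using spectrum_at_resolvent_norm[OF sa _ nontriv] by metis
  have "complex_of_real (- 1 / M) \<in> resolvent_set A"
    using pos M(1) by (intro resolvent_below_inf_spec) (auto intro: le_less_trans[of _ 0])
  then have spec: "complex_of_real (1 / M) \<in> spectrum_op A"
    using M(3) by (simp add: spectrum_op_def)
  have "1 / M \<le> Re z" if z: "z \<in> spectrum_op A" for z
  proof (rule ccontr)
    assume less: "\<not> 1 / M \<le> Re z"
    have "inf_spec A \<le> ereal (Re z)"
      unfolding inf_spec_def using z by (rule INF_lower)
    with pos have "Re z > 0"
      by (metis ereal_less(2) less_le_trans)
    have "complex_of_real (Re z) \<in> resolvent_set A"
    proof (rule resolvent_set_realI[OF sa])
      show "1 / M - Re z > 0"
        using less by simp
      fix x u assume "A x = Some u"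
      then have "1 / M * norm x \<le> norm u"
        using M(1) M(2)[of x u] by (simp add: divide_le_eq mult.commute)
      moreover have "norm u \<le> norm (u - Re z *\<^sub>R x) + Re z * norm x"
        using norm_triangle_sub[of u "Re z *\<^sub>R x"] \<open>Re z > 0\<close> by simp
      ultimately show "(1 / M - Re z) * norm x \<le> norm (u - Re z *\<^sub>R x)"
        by (simp add: algebra_simps)
    qed
    moreover have "complex_of_real (Re z) = z"
      using self_adjoint_spectrum_real[OF sa z] by (simp add: complex_eq_iff)
    ultimately show False
      using z by (simp add: spectrum_op_def)
  qed
  then have "inf_spec A = ereal (1 / M)"
    unfolding inf_spec_def using spec
    by (intro antisym INF_greatest INF_lower2[OF spec]) auto
  then show thesis
    using that[of "1 / M"] spec M(1) by simp
qed

section \<open>Square roots\<close>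

text \<open>With \<open>K = 1 - c G\<close> of norm at most 1, the iteration \<open>Y \<mapsto> (K + Y\<^sup>2) / 2\<close> is dominated by the
  scalar iteration \<open>y \<mapsto> (1 + y\<^sup>2) / 2\<close>, whose increments are summable because it increases and
  stays below 1. A fixed point satisfies \<open>(1 - Y)\<^sup>2 = c G\<close>.\<close>

lemma positive_blinfun_sqrt:
  fixes G :: "'a::complex_hilbert \<Rightarrow>\<^sub>L 'a"
  assumes "c > 0" and symG: "\<And>x y. cinner (G x) y = cinner x (G y)"
    and G_le: "\<And>x. c * (norm (G x))\<^sup>2 \<le> Re (cinner x (G x))"
  obtains R :: "'a \<Rightarrow>\<^sub>L 'a" where
    "\<And>x y. cinner (R x) y = cinner x (R y)"
    "\<And>x. R (R x) = G x"
    "\<And>x. 0 \<le> Re (cinner x (R x))"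
    "\<And>x. Re (cinner x (R x)) = 0 \<Longrightarrow> R x = 0"
    "\<And>(L :: 'a \<Rightarrow>\<^sub>L 'a) x. \<forall>x. L (G x) = G (L x) \<Longrightarrow> L (R x) = R (L x)"
proof -
  define K where "K = id_blinfun - c *\<^sub>R G"
  have K: "K x = x - c *\<^sub>R G x" for x
    by (simp add: K_def blinfun.diff_left blinfun.scaleR_left)
  have "norm K \<le> 1"
  proof (rule norm_blinfun_bound)
    fix x
    have "(norm (K x))\<^sup>2 = (norm x)\<^sup>2 - 2 * c * Re (cinner x (G x)) + c * (c * (norm (G x))\<^sup>2)"
      using norm_add_sq[of x "- (c *\<^sub>R G x)"]
      by (simp add: K cinner.minus_right cinner_scaleR_right power_mult_distrib power2_eq_square)
    also have "\<dots> \<le> (norm x)\<^sup>2 - 2 * c * Re (cinner x (G x)) + c * Re (cinner x (G x))"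
      using G_le[of x] \<open>c > 0\<close> by simp
    also have "\<dots> \<le> (norm x)\<^sup>2"
    proof -
      have "0 \<le> Re (cinner x (G x))"
        using G_le[of x] \<open>c > 0\<close> by (smt (verit) mult_nonneg_nonneg zero_le_power2)
      then show ?thesis
        using \<open>c > 0\<close> by simp
    qed
    finally show "norm (K x) \<le> 1 * norm x"
      by (simp add: power2_le_iff_abs_le)
  qed simp
  define Y where "Y = rec_nat 0 (\<lambda>_ Z. (1/2) *\<^sub>R (K + (Z o\<^sub>L Z)))"
  define y where "y = rec_nat (0::real) (\<lambda>_ z. (1/2) * (1 + z * z))"
  have Y_simps: "Y 0 = 0" "Y (Suc n) = (1/2) *\<^sub>R (K + (Y n o\<^sub>L Y n))" for n
    by (simp_all add: Y_def)
  have y_simps: "y 0 = 0" "y (Suc n) = (1/2) * (1 + y n * y n)" for n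
    by (simp_all add: y_def)
  have y_range: "0 \<le> y n \<and> y n \<le> 1" for n
  proof (induction n)
    case (Suc n)
    then have "y n * y n \<le> 1 * 1"
      by (intro mult_mono) auto
    then show ?case
      by (simp add: y_simps)
  qed (simp add: y_simps)
  \<comment> \<open>The increment is \<open>(1 - y n)^2 / 2\<close>.\<close>
  have "y n \<le> y (Suc n)" for n
    using zero_le_square[of "1 - y n"] by (simp add: y_simps field_simps)
  then have "incseq y"
    by (rule incseq_SucI)
  have "Cauchy y"
    using incseq_convergent[OF \<open>incseq y\<close>, of 1] y_range by (metis LIMSEQ_imp_Cauchy)
  have norm_Y: "norm (Y n) \<le> y n" for n
  proof (induction n)
    case (Suc n)
    have "norm (Y n o\<^sub>L Y n) \<le> y n * y n"
      using norm_blinfun_compose[of "Y n" "Y n"] mult_mono[OF Suc Suc] y_range[of n]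
      by (smt (verit) norm_ge_zero)
    then have "norm (K + (Y n o\<^sub>L Y n)) \<le> 1 + y n * y n"
      using norm_triangle_ineq[of K "Y n o\<^sub>L Y n"] \<open>norm K \<le> 1\<close> by linarith
    then show ?case
      by (simp add: Y_simps y_simps)
  qed (simp add: Y_simps y_simps)
  have step: "norm (Y (Suc n) - Y n) \<le> y (Suc n) - y n" for n
  proof (induction n)
    case 0
    show ?case
      using norm_Y[of 1] by (simp add: Y_simps y_simps)
  next
    case (Suc n)
    define D where "D = Y (Suc n) - Y n"
    have "Y (Suc (Suc n)) - Y (Suc n)
        = (1/2) *\<^sub>R ((Y (Suc n) o\<^sub>L Y (Suc n)) - (Y n o\<^sub>L Y n))"
      by (simp only: Y_simps(2)[of "Suc n"] Y_simps(2)[of n] scaleR_diff_right[symmetric] add_diff_cancel_left)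
    \<comment> \<open>A difference of squares split in an order that is valid for noncommuting
      factors; the scalar increments satisfy the same identity.\<close>
    also have "(Y (Suc n) o\<^sub>L Y (Suc n)) - (Y n o\<^sub>L Y n) = (Y (Suc n) o\<^sub>L D) + (D o\<^sub>L Y n)"
      by (rule blinfun_eqI) (simp add: D_def blinfun.diff_left blinfun.diff_right blinfun.add_left)
    finally have "norm (Y (Suc (Suc n)) - Y (Suc n)) = 1/2 * norm ((Y (Suc n) o\<^sub>L D) + (D o\<^sub>L Y n))"
      by simp
    also have "norm ((Y (Suc n) o\<^sub>L D) + (D o\<^sub>L Y n)) \<le> norm (Y (Suc n)) * norm D + norm D * norm (Y n)"
      by (intro order_trans[OF norm_triangle_ineq] add_mono norm_blinfun_compose)
    also have "\<dots> \<le> y (Suc n) * (y (Suc n) - y n) + (y (Suc n) - y n) * y n"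
      using Suc y_range incseq_SucD[OF \<open>incseq y\<close>, of n] unfolding D_def
      by (intro add_mono mult_mono norm_Y) (auto intro: order_trans[OF norm_ge_zero])
    also have "\<dots> = 2 * (y (Suc (Suc n)) - y (Suc n))"
      by (simp add: y_simps(2)[of "Suc n"] y_simps(2)[of n] algebra_simps)
    finally show ?case
      by simp
  qed
  have Y_diff: "norm (Y (n + k) - Y n) \<le> y (n + k) - y n" for n k
  proof (induction k)
    case (Suc k)
    then show ?case
      using step[of "n + k"] norm_triangle_ineq[of "Y (Suc (n + k)) - Y (n + k)" "Y (n + k) - Y n"]
      by simp
  qed simp
  have Y_dist: "dist (Y m) (Y n) \<le> dist (y m) (y n)" for m n
  proof (cases "n \<le> m")
    case True
    then show ?thesis
      using Y_diff[of n "m - n"] by (simp add: dist_norm)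
  next
    case False
    then show ?thesis
      using Y_diff[of m "n - m"] by (simp add: dist_norm norm_minus_commute[of "Y m"])
  qed
  have "Cauchy Y"
    using \<open>Cauchy y\<close> Y_dist unfolding Cauchy_def by (meson le_less_trans)
  then obtain Z where Z: "Y \<longlonglongrightarrow> Z"
    using Cauchy_convergent convergent_def by blast
  have Zx: "(\<lambda>n. Y n x) \<longlonglongrightarrow> Z x" for x
    by (intro blinfun.tendsto Z tendsto_const)
  have "Z = (1/2) *\<^sub>R (K + (Z o\<^sub>L Z))"
  proof (rule LIMSEQ_unique)
    show "(\<lambda>n. Y (Suc n)) \<longlonglongrightarrow> Z"
      using Z by (rule LIMSEQ_Suc)
    show "(\<lambda>n. Y (Suc n)) \<longlonglongrightarrow> (1/2) *\<^sub>R (K + (Z o\<^sub>L Z))"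
      unfolding Y_simps
      by (intro tendsto_intros bounded_bilinear.tendsto[OF bounded_bilinear_blinfun_compose] Z)
  qed
  then have "2 *\<^sub>R Z = K + (Z o\<^sub>L Z)"
    by (metis scaleR_2 field_sum_of_halves scaleR_one scaleR_add_left)
  then have ZZ: "Z (Z x) = 2 *\<^sub>R Z x - K x" for x
    by (metis add_diff_cancel_left' blinfun.add_left blinfun.scaleR_left blinfun_apply_blinfun_compose)
  have "norm Z \<le> 1"
    using Z by (intro LIMSEQ_le_const2[of "\<lambda>n. norm (Y n)"] tendsto_norm)
      (use norm_Y y_range order_trans in blast)+
  then have norm_Z: "norm (Z x) \<le> norm x" for x
    using norm_blinfun[of Z x] mult_right_mono[of "norm Z" 1 "norm x"] by simp
  have symY: "cinner (Y n x) y = cinner x (Y n y)" for n x y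
  proof (induction n arbitrary: x y)
    case (Suc n)
    have "cinner (K x) y = cinner x (K y)" for x y
      by (simp add: K cinner.diff_left cinner.diff_right cinner_scaleR_left cinner_scaleR_right symG)
    then show ?case
      by (simp add: Y_simps Suc blinfun.scaleR_left blinfun.add_left cinner_scaleR_left
          cinner_scaleR_right cinner.add_left cinner.add_right)
  qed (simp add: Y_simps cinner.zero_left cinner.zero_right)
  have symZ: "cinner (Z x) y = cinner x (Z y)" for x y
  proof (rule LIMSEQ_unique)
    show "(\<lambda>n. cinner (Y n x) y) \<longlonglongrightarrow> cinner (Z x) y"
      by (intro cinner.tendsto Zx tendsto_const)
    show "(\<lambda>n. cinner (Y n x) y) \<longlonglongrightarrow> cinner x (Z y)"
      unfolding symY by (intro cinner.tendsto Zx tendsto_const)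
  qed
  \<comment> \<open>An operator commuting with \<open>G\<close> commutes with \<open>K\<close>, with
    every iterate and with the limit. This commutation is what later gives uniqueness of the square
    root.\<close>
  have comm: "L (Z x) = Z (L x)" if L: "\<forall>x. L (G x) = G (L x)" for L :: "'a \<Rightarrow>\<^sub>L 'a" and x
  proof -
    have "L (Y n x) = Y n (L x)" for n x
    proof (induction n arbitrary: x)
      case (Suc n)
      then show ?case
        by (simp add: Y_simps K L blinfun.scaleR_left blinfun.add_left blinfun.scaleR_right
            blinfun.add_right blinfun.diff_right)
    qed (simp add: Y_simps blinfun.zero_right)
    moreover have "(\<lambda>n. L (Y n x)) \<longlonglongrightarrow> L (Z x)"
      by (intro blinfun.tendsto tendsto_const Zx)
    ultimately show ?thesis
      using LIMSEQ_unique[OF _ Zx[of "L x"]] by simp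
  qed
  define R where "R = (1 / sqrt c) *\<^sub>R (id_blinfun - Z)"
  have R: "R x = (1 / sqrt c) *\<^sub>R (x - Z x)" for x
    by (simp add: R_def blinfun.scaleR_left blinfun.diff_left)
  have ReR: "sqrt c * Re (cinner x (R x)) = (norm x)\<^sup>2 - Re (cinner x (Z x))" for x
    using \<open>c > 0\<close> by (simp add: R cinner_scaleR_right cinner.diff_right cinner_self)
  have le: "Re (cinner x (Z x)) \<le> (norm x)\<^sup>2" for x
  proof -
    have "Re (cinner x (Z x)) \<le> norm x * norm (Z x)"
      using complex_Re_le_cmod norm_cinner_le order_trans by blast
    also have "\<dots> \<le> norm x * norm x"
      using norm_Z by (intro mult_left_mono) auto
    finally show ?thesis
      by (simp add: power2_eq_square)
  qed
  show thesis
  proof (rule that)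
    show "cinner (R x) y = cinner x (R y)" for x y
      by (simp add: R cinner_scaleR_left cinner_scaleR_right cinner.diff_left cinner.diff_right symZ)
    show "R (R x) = G x" for x
    proof -
      have "R (R x) = (1 / sqrt c * (1 / sqrt c)) *\<^sub>R (x - Z x - Z (x - Z x))"
        by (simp only: R blinfun.scaleR_right scaleR_diff_right[symmetric] scaleR_scaleR)
      also have "x - Z x - Z (x - Z x) = c *\<^sub>R G x"
        by (simp add: blinfun.diff_right ZZ K scaleR_2)
      finally show ?thesis
        using \<open>c > 0\<close> by simp
    qed
    show "0 \<le> Re (cinner x (R x))" for x
    proof -
      have "0 \<le> sqrt c * Re (cinner x (R x))"
        using ReR[of x] le[of x] by simp
      then show ?thesis
        using \<open>c > 0\<close> by (simp add: zero_le_mult_iff)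
    qed
    \<comment> \<open>The assumption says \<open>Re (cinner x (Z x)) = (norm x)^2\<close>. As
      \<open>norm (Z x) \<le> norm x\<close>, this is the equality case of Cauchy-Schwarz and forces
      \<open>Z x = x\<close>.\<close>
    show "R x = 0" if "Re (cinner x (R x)) = 0" for x
    proof -
      have "(norm (Z x - x))\<^sup>2 = (norm (Z x))\<^sup>2 - 2 * Re (cinner x (Z x)) + (norm x)\<^sup>2"
        using norm_add_sq[of "Z x" "- x"] by (simp add: cinner.minus_right symZ)
      also have "Re (cinner x (Z x)) = (norm x)\<^sup>2"
        using ReR[of x] that by simp
      also have "(norm (Z x))\<^sup>2 \<le> (norm x)\<^sup>2"
        by (intro power_mono norm_Z) auto
      finally have "Z x = x"
        by simp
      then show ?thesis
        by (simp add: R)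
    qed
    show "L (R x) = R (L x)" if "\<forall>x. L (G x) = G (L x)" for L :: "'a \<Rightarrow>\<^sub>L 'a" and x
      by (simp add: R blinfun.scaleR_right blinfun.diff_right comm[OF that])
  qed
qed


text \<open>The square root of \<open>A\<close> is the inverse of the square root \<open>R\<close> of \<open>A\<^bsup>-1\<^esup>\<close>. Any other
  candidate also has a bounded nonnegative inverse \<open>R'\<close> with square \<open>A\<^bsup>-1\<^esup>\<close>, and
  \<open>(R + R') (R - R') = 0\<close> because \<open>R\<close> and \<open>R'\<close> commute.\<close>

lemma sqrt_op_inverse:
  fixes A :: "'a::complex_hilbert \<rightharpoonup> 'a"
  assumes sa: "self_adjoint A" and "a > 0"
    and lower: "\<And>x u. A x = Some u \<Longrightarrow> a * (norm x)\<^sup>2 \<le> Re (cinner x u)"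
  obtains R :: "'a \<Rightarrow>\<^sub>L 'a" where
    "\<And>x y. sqrt_op A y = Some x \<longleftrightarrow> R x = y"
    "\<And>x y. A y = Some x \<longleftrightarrow> R (R x) = y"
    "\<And>x y. cinner (R x) y = cinner x (R y)"
proof -
  have "complex_of_real 0 \<in> resolvent_set A"
  proof (rule resolvent_set_realI[OF sa \<open>a > 0\<close>])
    fix x u assume "A x = Some u"
    then have "a * (norm x)\<^sup>2 \<le> Re (cinner x u)"
      by (rule lower)
    also have "\<dots> \<le> norm x * norm u"
      using complex_Re_le_cmod norm_cinner_le order_trans by blast
    finally have "norm x * (a * norm x) \<le> norm x * norm u"
      by (simp add: power2_eq_square mult_ac)
    then show "a * norm x \<le> norm (u - 0 *\<^sub>R x)"
      by (cases "x = 0") auto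
  qed
  then obtain G :: "'a \<Rightarrow>\<^sub>L 'a" where G: "\<And>x y. A y = Some x \<longleftrightarrow> G x = y"
    and symG: "\<And>x y. cinner (G x) y = cinner x (G y)"
    using resolvent_real_inverse[OF sa] by (metis add.right_neutral scaleR_zero_left)
  \<comment> \<open>The lower bound of \<open>A\<close> at the vector \<open>G x\<close>; this makes
    \<open>c = a\<close> admissible for the square root iteration.\<close>
  have G_le: "a * (norm (G x))\<^sup>2 \<le> Re (cinner x (G x))" for x
    using lower[of "G x" x] G symG[of x x] by simp
  obtain R :: "'a \<Rightarrow>\<^sub>L 'a" where symR: "\<And>x y. cinner (R x) y = cinner x (R y)"
    and RR: "\<And>x. R (R x) = G x" and R_nonneg: "\<And>x. 0 \<le> Re (cinner x (R x))"
    and R_null: "\<And>x. Re (cinner x (R x)) = 0 \<Longrightarrow> R x = 0"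
    and R_comm: "\<And>(L :: 'a \<Rightarrow>\<^sub>L 'a) x. \<forall>x. L (G x) = G (L x) \<Longrightarrow> L (R x) = R (L x)"
    by (rule positive_blinfun_sqrt[OF \<open>a > 0\<close> symG G_le]) blast
  have injR: "inj R"
  proof (rule injI)
    fix x y assume "R x = R y"
    then have "G x = G y"
      by (simp flip: RR)
    then show "x = y"
      using G[of "G y" x] G[of "G y" y] by simp
  qed
  define S where "S y = (if y \<in> range R then Some (inv R y) else None)" for y
  have S: "S y = Some x \<longleftrightarrow> R x = y" for x y
    by (auto simp: S_def inv_f_f[OF injR] inj_eq[OF injR])
  have "sqrt_op A = S"
    unfolding sqrt_op_def
  proof (rule the_equality)
    have "(S \<circ>\<^sub>m S) y = Some x \<longleftrightarrow> A y = Some x" for x y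
      by (auto simp: map_comp_Some_iff S G RR)
    then have "S \<circ>\<^sub>m S = A"
      by (metis ext option.exhaust)
    moreover have "nonneg_op S"
      unfolding nonneg_op_def
    proof
      fix y assume "y \<in> dom S"
      then obtain x where x: "S y = Some x"
        by blast
      then have "y = R x"
        using S by simp
      then show "0 \<le> Re (cinner y (the (S y)))"
        using R_nonneg[of x] x by (simp add: symR)
    qed
    ultimately show "self_adjoint S \<and> nonneg_op S \<and> S \<circ>\<^sub>m S = A"
      using inverse_symmetric_self_adjoint[OF S symR] by blast
  next
    fix S' :: "'a \<rightharpoonup> 'a"
    assume "self_adjoint S' \<and> nonneg_op S' \<and> S' \<circ>\<^sub>m S' = A"
    then have sa': "self_adjoint S'" and nonneg': "nonneg_op S'" and sq: "S' \<circ>\<^sub>m S' = A"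
      by auto
    have A_iff: "A y = Some x \<longleftrightarrow> (\<exists>w. S' y = Some w \<and> S' w = Some x)" for x y
      unfolding sq[symmetric] by (auto simp: map_comp_Some_iff)
    have "\<exists>y. S' y = Some x" for x
      using G A_iff by metis
    then obtain F where F: "\<And>x. S' (F x) = Some x"
      by metis
    \<comment> \<open>Two preimages differ by a kernel vector of \<open>S'\<close>, which lies in
      the kernel of \<open>A\<close> because \<open>S' 0 = 0\<close>; and \<open>A\<close> is
      injective.\<close>
    have uniq: "y = F x" if "S' y = Some x" for x y
    proof -
      have "S' (y - F x) = Some 0"
        using linear_operatorD(4)[OF self_adjointD(1)[OF sa'] that F[of x]] by simp
      moreover have "S' 0 = Some 0"
        using linear_operatorD(3)[OF self_adjointD(1)[OF sa'] that that] .
      ultimately have "A (y - F x) = Some 0"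
        using A_iff by blast
      then have "G 0 = y - F x"
        using G by blast
      then show ?thesis
        by (simp add: blinfun.zero_right)
    qed
    have symF: "cinner (F x) y = cinner x (F y)" for x y
      using self_adjoint_symmetric[OF sa' F[of x] F[of y]] .
    have FF: "F (F x) = G x" for x
      using A_iff[of "F (F x)" x] F G by metis
    have "bounded_linear F"
    proof (rule bounded_linear_intro[where K = "sqrt (norm G)"])
      fix x
      have "complex_of_real ((norm (F x))\<^sup>2) = cinner x (G x)"
        unfolding cinner_self[symmetric] by (simp add: symF FF)
      then have "(norm (F x))\<^sup>2 = norm (cinner x (G x))"
        by (metis norm_of_real abs_power2)
      also have "\<dots> \<le> norm x * norm (G x)"
        by (rule norm_cinner_le)
      also have "\<dots> \<le> norm x * (norm G * norm x)"
        by (intro mult_left_mono norm_blinfun) auto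
      also have "\<dots> = (norm x * sqrt (norm G))\<^sup>2"
        by (simp add: power_mult_distrib power2_eq_square)
      finally show "norm (F x) \<le> norm x * sqrt (norm G)"
        by (rule power2_le_imp_le) simp
    qed (rule symmetric_linear[OF symF])+
    then have "blinfun_apply (Blinfun F) = F"
      by (rule bounded_linear_Blinfun_apply)
    then have RF: "F (R x) = R (F x)" for x
      using R_comm[of "Blinfun F"] FF by metis
    have F_nonneg: "0 \<le> Re (cinner x (F x))" for x
      using nonneg' F[of x] symF[of x x] unfolding nonneg_op_def by (metis domI option.sel)
    have "F x = R x" for x
    proof -
      define z where "z = R x - F x"
      have "F z = F (R x) - F (F x)"
        using symmetric_linear(1)[OF symF, of z "F x"] by (simp add: z_def)
      then have "R z + F z = 0"
        by (simp add: z_def blinfun.diff_right RR FF RF)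
      \<comment> \<open>Both summands have nonnegative real part, so both real parts vanish; for
        \<open>R\<close> this already gives \<open>R z = 0\<close>, and injectivity gives
        \<open>z = 0\<close>.\<close>
      then have "cinner z (R z) + cinner z (F z) = 0"
        by (simp add: cinner.zero_right flip: cinner_add_right)
      then have "Re (cinner z (R z)) + Re (cinner z (F z)) = 0"
        by (metis plus_complex.sel(1) zero_complex.sel(1))
      then have "R z = 0"
        using R_nonneg[of z] F_nonneg[of z] by (intro R_null) linarith
      then have "z = 0"
        using injD[OF injR, of z 0] by (simp add: blinfun.zero_right)
      then show ?thesis
        by (simp add: z_def)
    qed
    then have "S' y = Some x \<longleftrightarrow> S y = Some x" for x y
      using F uniq S by metis
    then show "S' = S"
      by (metis ext option.exhaust)
  qed
  with that[of R] S G RR symR show thesis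
    by simp
qed

section \<open>Operators given by indefinite forms\<close>

lemma form_op_inverse:
  assumes R: "\<And>x y. sqrt_op A y = Some x \<longleftrightarrow> R x = y"
    and J: "\<And>x y. H y = Some x \<longleftrightarrow> J x = y"
  shows "form_op A H y = Some x \<longleftrightarrow> R (J (R x)) = y"
proof -
  have "form_op A H y = Some x
      \<longleftrightarrow> (\<exists>u v. sqrt_op A y = Some u \<and> H u = Some v \<and> sqrt_op A v = Some x)"
    by (auto simp: form_op_def map_comp_Some_iff)
  then show ?thesis
    by (simp add: R J)
qed

lemma associated_with_form_form_op:
  assumes sa: "self_adjoint (sqrt_op A)"
  shows "associated_with_form (form_op A H) (form_dom A) (form A H)"
proof -
  have *: "\<exists>u v. sqrt_op A y = Some u \<and> H u = Some v \<and> sqrt_op A v = Some w"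
    if "form_op A H y = Some w" for y w
    using that by (auto simp: form_op_def map_comp_Some_iff)
  have "form A H x y = cinner x w" if "form_op A H y = Some w" "sqrt_op A x = Some v" for x y v w
    using *[OF that(1)] that(2) self_adjoint_symmetric[OF sa that(2)] by (auto simp: form_def)
  then show ?thesis
    unfolding associated_with_form_def form_dom_def using * by fastforce
qed

text \<open>Read for fixed \<open>y\<close>, the form identity says that \<open>H A^(1/2) y\<close>
  lies in the domain of the adjoint of A^(1/2), with value \<open>C y\<close>. Since A^(1/2) is its
  own adjoint, \<open>C\<close> is a restriction of \<open>form_op A H\<close>, and maximality gives
  equality.\<close>

lemma associated_with_form_unique:
  assumes sa: "self_adjoint (sqrt_op A)" and H: "dom H = UNIV"
    and B: "self_adjoint (form_op A H)" and C: "self_adjoint C"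
    and assoc: "associated_with_form C (form_dom A) (form A H)"
  shows "C = form_op A H"
proof (rule self_adjoint_maximal[OF C B])
  show "C \<subseteq>\<^sub>m form_op A H"
    unfolding map_le_def
  proof
    fix y assume "y \<in> dom C"
    then obtain w where w: "C y = Some w"
      by blast
    have "y \<in> dom (sqrt_op A)"
      using assoc \<open>y \<in> dom C\<close> by (auto simp: associated_with_form_def form_dom_def)
    then obtain u where u: "sqrt_op A y = Some u"
      by blast
    obtain v where v: "H u = Some v"
      using H by blast
    have "cinner p v = cinner x w" if "sqrt_op A x = Some p" for x p
      using assoc that w u v unfolding associated_with_form_def form_dom_def form_def
      by (metis domI option.sel)
    then have "sqrt_op A v = Some w"
      using self_adjointD(3)[OF sa] by (metis cinner_commute)
    then show "C y = form_op A H y"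
      using w u v by (simp add: form_op_def map_comp_def)
  qed
qed

text \<open>On the domain of \<open>form_op A H\<close> the graph of A^(1/2) consists of the pairs
  \<open>(R (J (R w)), J (R w))\<close>. A general pair \<open>(R u, u)\<close> has
  \<open>u = J v\<close>, and approximating \<open>v\<close> from the dense range of
  \<open>R\<close> suffices because \<open>R\<close> and \<open>J\<close> are bounded.\<close>

lemma form_op_core:
  fixes R J :: "'a::complex_hilbert \<Rightarrow>\<^sub>L 'a"
  assumes sa: "self_adjoint (sqrt_op A)" and H: "dom H = UNIV"
    and B: "self_adjoint (form_op A H)"
    and R: "\<And>x y. sqrt_op A y = Some x \<longleftrightarrow> R x = y"
    and J: "\<And>x y. H y = Some x \<longleftrightarrow> J x = y"
  shows "is_core (dom (form_op A H)) (sqrt_op A)"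
proof -
  define D where "D = dom (form_op A H)"
  have D: "D = range (\<lambda>w. R (J (R w)))"
    using form_op_inverse[of A R H J, OF R J] by (auto simp: D_def dom_def)
  then have "D \<subseteq> dom (sqrt_op A)"
    using R by blast
  moreover have "csubspace D"
    using self_adjointD(1)[OF B] by (simp add: linear_operator_def D_def)
  moreover have "closure (Map.graph (sqrt_op A |` D)) \<subseteq> Map.graph (sqrt_op A)"
  proof
    fix p assume "p \<in> closure (Map.graph (sqrt_op A |` D))"
    then obtain f where f: "\<And>n. f n \<in> Map.graph (sqrt_op A |` D)" "f \<longlonglongrightarrow> p"
      by (auto simp: closure_sequential)
    have "sqrt_op A (fst (f n)) = Some (snd (f n))" for n
      using f(1)[of n] by (auto simp: Map.graph_def restrict_map_def split: if_splits)
    then have "sqrt_op A (fst p) = Some (snd p)"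
      using tendsto_fst[OF f(2)] tendsto_snd[OF f(2)] by (rule self_adjoint_closed[OF sa])
    then show "p \<in> Map.graph (sqrt_op A)"
      by (auto simp: Map.graph_def intro: prod.collapse[symmetric])
  qed
  moreover have "Map.graph (sqrt_op A) \<subseteq> closure (Map.graph (sqrt_op A |` D))"
  proof
    fix p assume "p \<in> Map.graph (sqrt_op A)"
    then obtain u where p: "p = (R u, u)"
      using R by (auto simp: Map.graph_def)
    obtain v where "H u = Some v"
      using H by blast
    then have v: "J v = u"
      using J by blast
    have "dom (sqrt_op A) = range R"
      using R by (auto simp: dom_def)
    then have "v \<in> closure (range R)"
      using self_adjointD(2)[OF sa] by (simp add: densely_defined_def)
    then obtain f where f: "\<And>n. f n \<in> range R" "f \<longlonglongrightarrow> v"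
      by (auto simp: closure_sequential)
    have "(R (J (f n)), J (f n)) \<in> Map.graph (sqrt_op A |` D)" for n
      using f(1)[of n] R by (auto simp: Map.graph_def restrict_map_def D)
    moreover have "(\<lambda>n. (R (J (f n)), J (f n))) \<longlonglongrightarrow> p"
      unfolding p v[symmetric] by (intro tendsto_Pair blinfun.tendsto tendsto_const f(2))
    ultimately show "p \<in> closure (Map.graph (sqrt_op A |` D))"
      unfolding closure_sequential by (intro exI conjI allI)
  qed
  ultimately show ?thesis
    unfolding is_core_def D_def by blast
qed

text \<open>Conjugating with \<open>R = A\<^bsup>-1/2\<^esup>\<close> turns \<open>B - r\<close> into \<open>H - r A\<^bsup>-1\<^esup>\<close>. Since \<open>0 \<le> r A\<^bsup>-1\<^esup> \<le> r / a\<close> for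
  \<open>r \<ge> 0\<close>, this is a perturbation of \<open>H - s\<close> with \<open>s = r / (2 a)\<close> by an operator of norm at most
  \<open>\<bar>s\<bar>\<close>, while the distance of \<open>s\<close> to the spectrum of \<open>H\<close> exceeds \<open>\<bar>s\<bar>\<close>.\<close>

lemma form_op_gap:
  fixes A H :: "'a::complex_hilbert \<rightharpoonup> 'a" and R J :: "'a \<Rightarrow>\<^sub>L 'a"
  assumes H: "self_adjoint H" "dom H = UNIV" and B: "self_adjoint (form_op A H)"
    and R: "\<And>x y. sqrt_op A y = Some x \<longleftrightarrow> R x = y"
    and J: "\<And>x y. H y = Some x \<longleftrightarrow> J x = y"
    and "a > 0" and RR_le: "\<And>x. a * (norm (R (R x)))\<^sup>2 \<le> Re (cinner x (R (R x)))"
    and gap: "hm < 0" "0 < hp" "complex_of_real ` einterval hm hp \<subseteq> resolvent_set H"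
    and r: "hm < ereal (r / a)" "ereal (r / a) < hp"
  shows "complex_of_real r \<in> resolvent_set (form_op A H)"
proof -
  define s where "s = r / (2 * a)"
  have r_eq: "r = s * (2 * a)" and r_a: "r / a = 2 * s"
    using \<open>a > 0\<close> by (simp_all add: s_def)
  \<comment> \<open>Both 0 and \<open>2 s = r / a\<close> lie in the open gap, and \<open>s\<close>
    is their midpoint. Finite \<open>l\<close> and \<open>h\<close> strictly beyond them inside the
    gap give a radius \<open>d\<close> that strictly exceeds \<open>\<bar>s\<bar>\<close>, also for
    infinite endpoints.\<close>
  have "hm < ereal (min 0 (2 * s))" "ereal (max 0 (2 * s)) < hp"
    using gap(1,2) r by (auto simp: r_a min_def max_def zero_ereal_def)
  then obtain l h where l: "hm < ereal l" "ereal l < ereal (min 0 (2 * s))"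
    and h: "ereal (max 0 (2 * s)) < ereal h" "ereal h < hp"
    by (metis ereal_dense2)
  define d where "d = min (s - l) (h - s)"
  have d: "\<bar>s\<bar> < d"
    using l(2) h(1) by (auto simp: d_def)
  have H_below: "d * norm u \<le> norm (v - s *\<^sub>R u)" if "H u = Some v" for u v
  proof (rule self_adjoint_bounded_below_gap[OF H(1) _ _ that])
    show "0 < d"
      using d by simp
    fix t assume "\<bar>t - s\<bar> < d"
    then have "l < t" "t < h"
      by (auto simp: d_def)
    then have "t \<in> einterval hm hp"
      using l(1) h(2) by (auto simp: einterval_iff intro: less_trans[of hm "ereal l"] less_trans[of _ "ereal h"])
    then show "complex_of_real t \<in> resolvent_set H"
      using gap(3) by blast
  qed
  \<comment> \<open>\<open>R^2\<close> is the inverse of \<open>A\<close> and lies between 0 and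
    \<open>1 / a\<close>; subtracting the midpoint \<open>1 / (2 a)\<close> halves the norm
    bound.\<close>
  have RR_half: "norm (R (R u) - (1 / (2 * a)) *\<^sub>R u) \<le> 1 / (2 * a) * norm u" for u
  proof (rule power2_le_imp_le)
    have "Re (cinner (R (R u)) u) = Re (cinner u (R (R u)))"
      by (subst cinner_commute) simp
    then have "(norm (R (R u) - (1 / (2 * a)) *\<^sub>R u))\<^sup>2
        = (norm (R (R u)))\<^sup>2 - 1 / a * Re (cinner u (R (R u))) + (1 / (2 * a) * norm u)\<^sup>2"
      using norm_add_sq[of "R (R u)" "- ((1 / (2 * a)) *\<^sub>R u)"] \<open>a > 0\<close>
      by (simp add: cinner.minus_right cinner_scaleR_right power_divide power_mult_distrib)
    also have "(norm (R (R u)))\<^sup>2 \<le> 1 / a * Re (cinner u (R (R u)))"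
      using RR_le[of u] \<open>a > 0\<close> by (simp add: pos_le_divide_eq mult.commute)
    finally show "(norm (R (R u) - (1 / (2 * a)) *\<^sub>R u))\<^sup>2 \<le> (1 / (2 * a) * norm u)\<^sup>2"
      by simp
  qed (use \<open>a > 0\<close> in simp)
  define \<delta> where "\<delta> = d - \<bar>s\<bar>"
  have "\<delta> > 0"
    using d by (simp add: \<delta>_def)
  have below: "\<delta> * norm u \<le> norm (v - r *\<^sub>R R (R u))" if "H u = Some v" for u v
  proof -
    have "v - s *\<^sub>R u = (v - r *\<^sub>R R (R u)) + r *\<^sub>R (R (R u) - (1 / (2 * a)) *\<^sub>R u)"
      by (simp add: s_def algebra_simps)
    then have "norm (v - s *\<^sub>R u) \<le> norm (v - r *\<^sub>R R (R u)) + \<bar>r\<bar> * norm (R (R u) - (1 / (2 * a)) *\<^sub>R u)"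
      by (metis norm_triangle_ineq norm_scaleR)
    also have "\<bar>r\<bar> * norm (R (R u) - (1 / (2 * a)) *\<^sub>R u) \<le> \<bar>r\<bar> * (1 / (2 * a) * norm u)"
      by (intro mult_left_mono RR_half) simp
    also have "\<bar>r\<bar> * (1 / (2 * a) * norm u) = \<bar>s\<bar> * norm u"
      using \<open>a > 0\<close> by (simp add: s_def abs_divide abs_mult)
    finally show ?thesis
      using H_below[OF that] by (simp add: \<delta>_def algebra_simps)
  qed
  define N where "N = norm R + 1"
  have "N > 0"
    by (simp add: N_def add_nonneg_pos)
  have R_le: "norm (R x) \<le> N * norm x" for x
    using norm_blinfun[of R x] by (simp add: N_def distrib_right add_increasing2)
  show ?thesis
  \<comment> \<open>With \<open>u = J (R w)\<close> one has \<open>x = R u\<close> and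
    \<open>R (w - r x) = H u - r R^2 u\<close>. Passing from \<open>u\<close> to \<open>x\<close>
    and from \<open>w - r x\<close> to its image each cost one factor \<open>N\<close>.\<close>
  proof (rule resolvent_set_realI[OF B])
    show "\<delta> / N\<^sup>2 > 0"
      using \<open>\<delta> > 0\<close> \<open>N > 0\<close> by simp
    fix x w assume "form_op A H x = Some w"
    then have x: "x = R (J (R w))"
      using form_op_inverse[of A R H J, OF R J] by simp
    define u where "u = J (R w)"
    have "H u = Some (R w)"
      using J by (simp add: u_def)
    have "\<delta> * norm x \<le> \<delta> * (N * norm u)"
      using R_le[of u] \<open>\<delta> > 0\<close> by (simp add: x u_def)
    also have "\<dots> = N * (\<delta> * norm u)"
      by simp
    also have "\<dots> \<le> N * norm (R w - r *\<^sub>R R (R u))"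
      using below[OF \<open>H u = Some (R w)\<close>] \<open>N > 0\<close> by simp
    also have "R w - r *\<^sub>R R (R u) = R (w - r *\<^sub>R x)"
      by (simp add: x u_def blinfun.diff_right blinfun.scaleR_right)
    also have "N * norm (R (w - r *\<^sub>R x)) \<le> N * (N * norm (w - r *\<^sub>R x))"
      using R_le \<open>N > 0\<close> by simp
    finally show "\<delta> / N\<^sup>2 * norm x \<le> norm (w - r *\<^sub>R x)"
      using \<open>N > 0\<close> by (simp add: pos_divide_le_eq power2_eq_square mult_ac)
  qed
qed

theorem theorem2p3:
  fixes A H :: "'a::complex_hilbert \<rightharpoonup> 'a"
    and hm hp :: ereal
  assumes "self_adjoint A" and "self_adjoint H"
    and "inf_spec A > 0"
    and "bounded_op H" and "has_bounded_inverse H"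
    and "maximal_spectral_gap H hm hp"
  shows "self_adjoint (form_op A H)
    \<and> associated_with_form (form_op A H) (form_dom A) (form A H)
    \<and> (\<forall>C. self_adjoint C \<and> associated_with_form C (form_dom A) (form A H)
           \<longrightarrow> C = form_op A H)
    \<and> is_core (dom (form_op A H)) (sqrt_op A)
    \<and> ((\<exists>x::'a. x \<noteq> 0) \<longrightarrow> (\<exists>a. inf_spec A = ereal a \<and> complex_of_real a \<in> spectrum_op A))
    \<and> complex_of_real ` einterval (inf_spec A * hm) (inf_spec A * hp)
        \<subseteq> resolvent_set (form_op A H)"
proof -
  \<comment> \<open>On the zero space \<open>inf_spec A\<close> is infinite and cannot serve as
    \<open>a\<close>. There any positive number is a lower bound, and 1 is taken; the identification
    with \<open>inf_spec A\<close> is therefore conditional.\<close>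
  obtain a where "a > 0"
    and a_spec: "(\<exists>x::'a. x \<noteq> 0) \<Longrightarrow> inf_spec A = ereal a \<and> complex_of_real a \<in> spectrum_op A"
    and lower: "\<And>x u. A x = Some u \<Longrightarrow> a * (norm x)\<^sup>2 \<le> Re (cinner x u)"
  proof (cases "\<exists>x::'a. x \<noteq> 0")
    case True
    then obtain a where a: "a > 0" "inf_spec A = ereal a" "complex_of_real a \<in> spectrum_op A"
      using inf_spec_attained[OF assms(1,3)] by blast
    have "complex_of_real r \<in> resolvent_set A" if "r < a" for r
      using that a(2) by (intro resolvent_below_inf_spec) simp
    then show thesis
      using that[of a] a self_adjoint_lower_bound[OF assms(1)] by blast
  next
    case False
    have "1 * (norm x)\<^sup>2 \<le> Re (cinner x u)" for x u :: 'a
    proof -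
      have "x = 0"
        using False by blast
      then show ?thesis
        by (simp add: cinner.zero_left)
    qed
    then show thesis
      using that[of 1] False by auto
  qed
  obtain R :: "'a \<Rightarrow>\<^sub>L 'a" where R: "\<And>x y. sqrt_op A y = Some x \<longleftrightarrow> R x = y"
    and RR: "\<And>x y. A y = Some x \<longleftrightarrow> R (R x) = y"
    and symR: "\<And>x y. cinner (R x) y = cinner x (R y)"
    using sqrt_op_inverse[OF assms(1) \<open>a > 0\<close> lower] by metis
  have sa_sqrt: "self_adjoint (sqrt_op A)"
    using R symR by (rule inverse_symmetric_self_adjoint)
  have "complex_of_real 0 \<in> resolvent_set H"
    using assms(5) by (simp add: has_bounded_inverse_iff_0_resolvent)
  then obtain J :: "'a \<Rightarrow>\<^sub>L 'a" where J: "\<And>x y. H y = Some x \<longleftrightarrow> J x = y"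
    and symJ: "\<And>x y. cinner (J x) y = cinner x (J y)"
    using resolvent_real_inverse[OF assms(2)] by (metis add.right_neutral scaleR_zero_left)
  have H: "dom H = UNIV"
    using assms(2,4) by (rule self_adjoint_bounded_total)
  have B: "self_adjoint (form_op A H)"
  proof (rule inverse_symmetric_self_adjoint)
    show "form_op A H y = Some x \<longleftrightarrow> R (J (R x)) = y" for x y
      using R J by (rule form_op_inverse)
    show "cinner (R (J (R x))) y = cinner x (R (J (R y)))" for x y
      by (simp add: symR symJ)
  qed
  have gap: "hm < 0" "0 < hp" "complex_of_real ` einterval hm hp \<subseteq> resolvent_set H"
    using assms(6) by (auto simp: maximal_spectral_gap_def)
  have "complex_of_real r \<in> resolvent_set (form_op A H)"
    if r: "r \<in> einterval (inf_spec A * hm) (inf_spec A * hp)" for r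
  proof (cases "\<exists>x::'a. x \<noteq> 0")
    case True
    then have "ereal a * hm < ereal r" "ereal r < ereal a * hp"
      using r a_spec by (simp_all add: einterval_iff)
    \<comment> \<open>Division by the finite positive \<open>a\<close> in the extended reals; the
      case split also covers infinite gap endpoints.\<close>
    then have less: "hm < ereal (r / a)" "ereal (r / a) < hp"
      using \<open>a > 0\<close> by (cases hm; cases hp; simp add: field_simps)+
    have "a * (norm (R (R x)))\<^sup>2 \<le> Re (cinner x (R (R x)))" for x
      using lower[of "R (R x)" x] RR[of "R (R x)" x] by (simp add: symR)
    then show ?thesis
      using gap less by (rule form_op_gap[OF assms(2) H B R J \<open>a > 0\<close>])
  next
    case False
    show ?thesis
    proof (rule resolvent_set_realI[OF B zero_less_one])
      fix x w :: 'a
      have "x = 0"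
        using False by blast
      then show "1 * norm x \<le> norm (w - r *\<^sub>R x)"
        by simp
    qed
  qed
  then have "complex_of_real ` einterval (inf_spec A * hm) (inf_spec A * hp)
      \<subseteq> resolvent_set (form_op A H)"
    by blast
  moreover have "(\<exists>x::'a. x \<noteq> 0) \<longrightarrow> (\<exists>a. inf_spec A = ereal a \<and> complex_of_real a \<in> spectrum_op A)"
    using a_spec by blast
  moreover have "\<forall>C. self_adjoint C \<and> associated_with_form C (form_dom A) (form A H)
      \<longrightarrow> C = form_op A H"
    using associated_with_form_unique[OF sa_sqrt H B] by blast
  moreover have "is_core (dom (form_op A H)) (sqrt_op A)"
    using form_op_core[OF sa_sqrt H B R J] .
  ultimately show ?thesis
    using B associated_with_form_form_op[OF sa_sqrt] by (intro conjI)
qed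

end
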